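(* Fix $K>1$ and a distribution $F$ over the simplex $V=\{x\in\mathbb{R}^K:x_k\ge0,\ \sum_kx_k=1\}$. For a diagonal matrix $D\in\mathbb{R}^{K\times K}$ with positive diagonal entries let $\widetilde h_D=\mathbb{E}\big[D^{-1}\pi_i/\|D^{-1}\pi_i\|_1\big]$, $\pi_i\sim F$. Consider a sequence of DCMM model pairs indexed by $n$: $$H_0^{(n)}:\ \Omega=\theta\theta'\qquad\text{and}\qquad H_1^{(n)}:\ \Omega=\widetilde\Theta\Pi P\Pi'\widetilde\Theta,$$ where $\Pi=[\pi_1,\ldots,\pi_n]'$ with $\pi_i\stackrel{iid}{\sim}F$. Suppose there exists a diagonal matrix $D$ with positive diagonal entries such that $$DPD\widetilde h_D=1_K,\qquad\min_{1\le k\le K}\{\widetilde h_{D,k}\}\ge C$$ for a constant $C>0$, and let $\widetilde\Theta=\mathrm{diag}(\widetilde\theta_1,\ldots,\widetilde\theta_n)$ with $\widetilde\theta_i=\theta_i/\|D^{-1}\pi_i\|_1$, $1\le i\le n$. If $\theta_{\max}\le c_0$ for a constant $c_0<1$ and $$\|\theta\|\cdot|\mu_2(P)|\to0,$$ then for each pair of two hypotheses the $\chi^2$-distance between the two joint distributions tends to $0$ as $n\to\infty$.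
   Context: $\theta\in\mathbb{R}^n$ has positive entries; $P\in\mathbb{R}^{K\times K}$ is symmetric, entrywise nonnegative, with unit diagonal; $\theta$ and $P$ (hence $D$) are non-stochastic and may depend on $n$. Given $\Omega$ (possibly random through $\Pi$), the adjacency matrix $A\in\{0,1\}^{n\times n}$ is symmetric with zero diagonal, and its entries $A_{ij}$, $i<j$, are conditionally independent Bernoulli with $\mathbb{P}(A_{ij}=1\mid\Omega)=\Omega_{ij}\in[0,1]$. The two joint distributions are the laws $P_0^{(n)}$, $P_1^{(n)}$ of $A$ under $H_0^{(n)}$ and $H_1^{(n)}$ (under $H_1^{(n)}$, averaged over $\Pi$). Their $\chi^2$-distance is $\int(dP_1^{(n)}/dP_0^{(n)})^2\,dP_0^{(n)}-1$. $\mu_k(P)$ is the $k$-th largest eigenvalue of $P$ in magnitude. $\|\theta\|$ is the $\ell^2$-norm, $\|\cdot\|_1$ the $\ell^1$-norm, $\theta_{\max}=\max_i\theta_i$, $1_K$ is the all-ones vector. *)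

theory Defs
  imports "HOL-Probability.Probability" "HOL-Computational_Algebra.Polynomial"
begin

definition prob_simplex :: "(real ^ 'k) set" where
  "prob_simplex = {x. (\<forall>k. 0 \<le> x $ k) \<and> (\<Sum>k\<in>UNIV. x $ k) = 1}"

definition l1_norm :: "real ^ 'k \<Rightarrow> real" where
  "l1_norm x = (\<Sum>k\<in>UNIV. \<bar>x $ k\<bar>)"

definition pos_diagonal :: "real ^ 'k ^ 'k \<Rightarrow> bool" where
  "pos_diagonal D \<longleftrightarrow> (\<forall>k. 0 < D $ k $ k) \<and> (\<forall>k l. k \<noteq> l \<longrightarrow> D $ k $ l = 0)"

definition charpoly :: "real ^ 'k ^ 'k \<Rightarrow> real poly" where
  "charpoly P = det (mat [:0, 1:] - (\<chi> i j. [:P $ i $ j:]))"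

text \<open>The \<open>k\<close>-th largest eigenvalue in magnitude (\<open>k\<close> counted from 1), with multiplicity.
  Meant for symmetric matrices, whose characteristic polynomials split over the reals.
  Only the magnitude of the result is canonical: the order of \<open>\<lambda>\<close> and \<open>-\<lambda>\<close> is arbitrary.\<close>

definition eigenvalue_mag :: "nat \<Rightarrow> real ^ 'k ^ 'k \<Rightarrow> real" where
  "eigenvalue_mag k P =
     rev (sort_key abs (sorted_list_of_multiset (proots (charpoly P)))) ! (k - 1)"

definition h_tilde :: "(real ^ 'k) measure \<Rightarrow> real ^ 'k ^ 'k \<Rightarrow> real ^ 'k" where
  "h_tilde F D =
     (\<integral>x. (matrix_inv D *v x) /\<^sub>R l1_norm (matrix_inv D *v x) \<partial>F)"

text \<open>Vectors and matrices whose size is the number \<open>n\<close> of nodes are functions on the indices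
  \<open>0, \<dots>, n - 1\<close>. An adjacency matrix vanishes outside these indices; the law below takes its
  entries above the diagonal from independent coin flips. The library's \<open>bernoulli_pmf\<close> truncates
  its parameter to \<open>[0, 1]\<close>, so \<open>\<Omega> i j \<in> [0, 1]\<close> has to be assumed separately.\<close>

definition adjacency_pmf :: "nat \<Rightarrow> (nat \<Rightarrow> nat \<Rightarrow> real) \<Rightarrow> (nat \<Rightarrow> nat \<Rightarrow> nat) pmf" where
  "adjacency_pmf n \<Omega> =
     map_pmf (\<lambda>e i j. if i < j then of_bool (e (i, j)) else if j < i then of_bool (e (j, i)) else 0)
       (Pi_pmf {(i, j). i < j \<and> j < n} False (\<lambda>(i, j). bernoulli_pmf (\<Omega> i j)))"

definition Omega_null :: "(nat \<Rightarrow> real) \<Rightarrow> nat \<Rightarrow> nat \<Rightarrow> real" where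
  "Omega_null \<theta> i j = \<theta> i * \<theta> j"

definition theta_tilde ::
    "(nat \<Rightarrow> real) \<Rightarrow> real ^ 'k ^ 'k \<Rightarrow> (nat \<Rightarrow> real ^ 'k) \<Rightarrow> nat \<Rightarrow> real" where
  "theta_tilde \<theta> D \<pi> i = \<theta> i / l1_norm (matrix_inv D *v \<pi> i)"

definition Omega_alt ::
    "(nat \<Rightarrow> real) \<Rightarrow> real ^ 'k ^ 'k \<Rightarrow> real ^ 'k ^ 'k \<Rightarrow> (nat \<Rightarrow> real ^ 'k) \<Rightarrow> nat \<Rightarrow> nat \<Rightarrow> real" where
  "Omega_alt \<theta> P D \<pi> i j =
     theta_tilde \<theta> D \<pi> i * (\<pi> i \<bullet> (P *v \<pi> j)) * theta_tilde \<theta> D \<pi> j"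

definition membership_law :: "nat \<Rightarrow> (real ^ 'k) measure \<Rightarrow> (nat \<Rightarrow> real ^ 'k) measure" where
  "membership_law n F = (\<Pi>\<^sub>M i\<in>{..<n}. F)"

definition null_law :: "nat \<Rightarrow> (nat \<Rightarrow> real) \<Rightarrow> (nat \<Rightarrow> nat \<Rightarrow> nat) measure" where
  "null_law n \<theta> = measure_pmf (adjacency_pmf n (Omega_null \<theta>))"

definition alt_law ::
    "nat \<Rightarrow> (real ^ 'k) measure \<Rightarrow> (nat \<Rightarrow> real) \<Rightarrow> real ^ 'k ^ 'k \<Rightarrow> real ^ 'k ^ 'k
      \<Rightarrow> (nat \<Rightarrow> nat \<Rightarrow> nat) measure" where
  "alt_law n F \<theta> P D =
     membership_law n F \<bind> (\<lambda>\<pi>. measure_pmf (adjacency_pmf n (Omega_alt \<theta> P D \<pi>)))"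

text \<open>The \<open>\<chi>\<^sup>2\<close>-distance of \<open>N\<close> from \<open>M\<close>. It is infinite if \<open>N\<close> has no density with respect to
  \<open>M\<close>, in which case \<open>RN_deriv M N\<close> would be zero by convention.\<close>

definition chi_square_dist :: "'a measure \<Rightarrow> 'a measure \<Rightarrow> ereal" where
  "chi_square_dist M N =
     (if absolutely_continuous M N then enn2ereal (\<integral>\<^sup>+x. (RN_deriv M N x)\<^sup>2 \<partial>M) - 1 else \<infinity>)"

end

theory Submission
  imports Defs
begin

text \<open>
  The second moment method with two independent replicas. Put
  \<open>h\<^sub>i = D\<inverse>\<pi>\<^sub>i / \<parallel>D\<inverse>\<pi>\<^sub>i\<parallel>\<^sub>1\<close>, a random point of the simplex with mean \<open>h\<close> (the vector \<open>h_tilde F D\<close>),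
  \<open>y\<^sub>i = h\<^sub>i - h\<close> and \<open>G = D P D - 1 1'\<close>. The normalisation \<open>D P D h = 1\<close> says \<open>G h = 0\<close>, so that the
  two hypotheses differ only by a centred bilinear perturbation:
  \<open>\<Omega>\<^sub>i\<^sub>j = \<theta>\<^sub>i \<theta>\<^sub>j (1 + y\<^sub>i' G y\<^sub>j)\<close> (\<open>Omega_alt_profile\<close>, \<open>bilinear_centred\<close>).

  Size of \<open>G\<close>. Its entries are \<open>O(\<bar>\<mu>\<^sub>2(P)\<bar>)\<close> (\<open>sandwich_near_one\<close>). Up to an error of operator norm
  \<open>\<bar>\<mu>\<^sub>2(P)\<bar>\<close>, \<open>P\<close> is the rank one matrix of its top eigenvector. The vector \<open>u = D h\<close> satisfies
  \<open>u' P u = 1\<close> and \<open>\<parallel>u\<parallel> \<le> 1\<close>, so if \<open>\<mu>\<^sub>2(P)\<close> is small it sees the top eigenvector well, and the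
  form of \<open>P\<close> is then small on all vectors that are \<open>P\<close>-orthogonal to \<open>u\<close>. The entries of \<open>G\<close> are
  values of the form at such vectors, namely \<open>D (e\<^sub>k - h)\<close>. If \<open>\<mu>\<^sub>2(P)\<close> is not small, the bound
  \<open>(D P D)\<^sub>k\<^sub>l \<le> 1 / C\<close>, which comes from \<open>D P D h = 1\<close> and \<open>h \<ge> C\<close>, is enough.

  Second moment. Let \<open>z\<^sub>i\<close> be the copy of \<open>y\<^sub>i\<close> made from an independent copy \<open>\<pi>'\<close> of the
  memberships, and let \<open>a\<^sub>i\<^sub>j = \<theta>\<^sub>i \<theta>\<^sub>j / (1 - \<theta>\<^sub>i \<theta>\<^sub>j)\<close>. Then
  \<open>\<chi>\<^sup>2 + 1 = E (\<Prod>\<^bsub>i<j\<^esub> (1 + a\<^sub>i\<^sub>j (y\<^sub>i' G y\<^sub>j) (z\<^sub>i' G z\<^sub>j))) \<le> E (exp S)\<close>,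
  where \<open>S = \<Sum>\<^bsub>i<j\<^esub> a\<^sub>i\<^sub>j (y\<^sub>i' G y\<^sub>j) (z\<^sub>i' G z\<^sub>j)\<close>
  (\<open>likelihood_ratio_moment_le_exp\<close>, \<open>chi_square_mixture\<close>). Fix \<open>\<pi>'\<close> and integrate over \<open>\<pi>\<close> only.
  Expanding \<open>1 / (1 - \<theta>\<^sub>i \<theta>\<^sub>j)\<close> as a geometric series turns \<open>S\<close> into a weighted sum of quadratic forms
  with product weights, and each of them is at most a sum of squares of linear statistics
  \<open>\<Sum>\<^sub>i b\<^sub>i y\<^sub>i\<^sub>,\<^sub>k\<close> plus a small deterministic diagonal term (\<open>chaos_bound\<close>). By convexity of the
  exponential it suffices to bound the exponential moment of one such square, which follows from
  Hoeffding's lemma after the square is linearised by an auxiliary Gaussian variable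
  (\<open>iid_exp_square_moment\<close>). The outcome is \<open>\<chi>\<^sup>2 + 1 \<le> exp \<epsilon> / sqrt (1 - 2 \<epsilon>)\<close> where \<open>\<epsilon>\<close> is a constant
  times \<open>(\<parallel>\<theta>\<parallel> \<bar>\<mu>\<^sub>2(P)\<bar>)\<^sup>2\<close>.
\<close>

section \<open>The spectral theorem and the second eigenvalue\<close>

lemma linear_term_zero_if_le_quadratic:
  fixes a b :: real
  assumes "\<And>t. 2 * t * a \<le> t\<^sup>2 * b"
  shows "a = 0"
proof (rule ccontr)
  assume a: "a \<noteq> 0"
  \<comment> \<open>Any multiple of \<open>a\<close> small enough to make the quadratic term negligible would do.\<close>
  define t where "t = a / (\<bar>b\<bar> + 1)"
  have "2 * a\<^sup>2 / (\<bar>b\<bar> + 1) \<le> a\<^sup>2 / (\<bar>b\<bar> + 1) * (b / (\<bar>b\<bar> + 1))"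
    using assms[of t] by (simp add: t_def power2_eq_square field_simps)
  also have "\<dots> \<le> a\<^sup>2 / (\<bar>b\<bar> + 1) * 1"
    by (intro mult_left_mono) (auto simp: divide_le_eq)
  finally have "a\<^sup>2 / (\<bar>b\<bar> + 1) \<le> 0" by simp
  with a show False by (simp add: divide_le_0_iff)
qed

text \<open>
  A maximiser of the quadratic form on the unit sphere of \<open>W\<close> is an eigenvector: the residual
  \<open>T v - l v\<close> lies in \<open>W\<close>, and moving \<open>v\<close> in its direction would otherwise increase the
  Rayleigh quotient to first order.
\<close>

lemma self_adjoint_eigenvector_in_subspace:
  fixes T :: "'a::euclidean_space \<Rightarrow> 'a"
  assumes T: "linear T" "\<And>x y. T x \<bullet> y = x \<bullet> T y"
    and W: "subspace W" "T ` W \<subseteq> W" and "w \<in> W" "w \<noteq> 0"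
  shows "\<exists>v\<in>W. norm v = 1 \<and> (\<exists>l. T v = l *\<^sub>R v)"
proof -
  let ?S = "W \<inter> sphere 0 1"
  have compact: "compact ?S"
    by (simp add: W(1) closed_Int_compact closed_subspace)
  have "(1 / norm w) *\<^sub>R w \<in> ?S"
    using W(1) assms(5,6) by (simp add: subspace_scale)
  then have ne: "?S \<noteq> {}" by blast
  have cont: "continuous_on ?S (\<lambda>x. x \<bullet> T x)"
    by (intro continuous_on_inner continuous_on_id linear_continuous_on)
      (use T(1) in \<open>simp add: linear_conv_bounded_linear\<close>)
  obtain v where v: "v \<in> ?S" and "\<forall>x\<in>?S. x \<bullet> T x \<le> v \<bullet> T v"
    using continuous_attains_sup[OF compact ne cont] by blast
  then have max: "x \<bullet> T x \<le> v \<bullet> T v" if "x \<in> ?S" for x using that by blast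
  define l where "l = v \<bullet> T v"
  have vv: "v \<bullet> v = 1" "v \<in> W" using v by (auto simp: norm_eq_1)
  have bound: "x \<bullet> T x \<le> l * (x \<bullet> x)" if "x \<in> W" for x
  proof (cases "x = 0")
    case True
    then show ?thesis using linear_0[OF T(1)] by simp
  next
    case False
    have "(1 / norm x) *\<^sub>R x \<in> ?S"
      using W(1) that False by (simp add: subspace_scale)
    from max[OF this] have "(x \<bullet> T x) / (norm x)\<^sup>2 \<le> l"
      by (simp add: l_def linear_scale[OF T(1)] power2_eq_square)
    then show ?thesis using False by (simp add: divide_le_eq power2_norm_eq_inner)
  qed
  define r where "r = T v - l *\<^sub>R v"
  have r: "r \<in> W" using W vv(2) by (auto simp: r_def intro!: subspace_diff subspace_scale)
  have "2 * t * (r \<bullet> r) \<le> t\<^sup>2 * (l * (r \<bullet> r) - r \<bullet> T r)" for t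
  proof -
    have "v + t *\<^sub>R r \<in> W" using W(1) vv(2) r by (intro subspace_add subspace_scale)
    from bound[OF this]
    have le: "(v + t *\<^sub>R r) \<bullet> T (v + t *\<^sub>R r) \<le> l * ((v + t *\<^sub>R r) \<bullet> (v + t *\<^sub>R r))" .
    have sym: "v \<bullet> T r = r \<bullet> T v" "v \<bullet> r = r \<bullet> v"
      by (metis T(2) inner_commute) (rule inner_commute)
    have Tadd: "T (v + t *\<^sub>R r) = T v + t *\<^sub>R T r"
      using T(1) by (simp add: linear_add linear_scale)
    have "v \<bullet> T v + 2 * t * (r \<bullet> T v) + t\<^sup>2 * (r \<bullet> T r)
        \<le> l * (v \<bullet> v) + 2 * t * (l * (r \<bullet> v)) + t\<^sup>2 * (l * (r \<bullet> r))"
      using le unfolding Tadd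
      by (simp add: inner_add_left inner_add_right sym algebra_simps power2_eq_square)
    moreover have "r \<bullet> r = r \<bullet> T v - l * (r \<bullet> v)"
      by (subst (2) r_def) (simp add: inner_simps)
    then have "2 * t * (r \<bullet> r) = 2 * t * (r \<bullet> T v) - 2 * t * (l * (r \<bullet> v))"
      by (simp only: right_diff_distrib)
    moreover have "l * (v \<bullet> v) = v \<bullet> T v"
      by (simp add: vv(1) l_def)
    ultimately show ?thesis
      unfolding right_diff_distrib by linarith
  qed
  then have "r \<bullet> r = 0" by (rule linear_term_zero_if_le_quadratic)
  then have "T v = l *\<^sub>R v" by (simp add: r_def)
  then show ?thesis using v by auto
qed

definition eigen_system :: "('a::euclidean_space \<Rightarrow> 'a) \<Rightarrow> 'a set \<Rightarrow> bool" where
  "eigen_system T B \<longleftrightarrow> pairwise orthogonal B \<and> (\<forall>b\<in>B. norm b = 1 \<and> (\<exists>l. T b = l *\<^sub>R b))"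

lemma eigen_system_independent: "eigen_system T B \<Longrightarrow> independent B"
  by (rule pairwise_orthogonal_independent) (auto simp: eigen_system_def)

text \<open>
  A maximal orthonormal system of eigenvectors spans: its orthogonal complement is invariant,
  and an eigenvector in it would extend the system.
\<close>

lemma spectral_theorem_self_adjoint:
  fixes T :: "'a::euclidean_space \<Rightarrow> 'a"
  assumes T: "linear T" "\<And>x y. T x \<bullet> y = x \<bullet> T y"
  shows "\<exists>B. eigen_system T B \<and> finite B \<and> card B = DIM('a)"
proof -
  have fin: "finite B \<and> card B \<le> DIM('a)" if "eigen_system T B" for B
    using independent_bound[OF eigen_system_independent[OF that]] .
  have "\<exists>B. eigen_system T B \<and> (\<forall>B'. eigen_system T B' \<longrightarrow> card B' \<le> card B)"
    by (rule ex_has_greatest_nat[of _ "{}" _ "Suc DIM('a)"]) (use fin in \<open>auto simp: less_Suc_eq_le eigen_system_def[of T "{}"]\<close>)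
  then obtain B where B: "eigen_system T B" and max: "\<And>B'. eigen_system T B' \<Longrightarrow> card B' \<le> card B"
    by blast
  have "span B = UNIV"
  proof (rule ccontr)
    assume "span B \<noteq> UNIV"
    then obtain w where w: "w \<noteq> 0" "\<forall>x\<in>span B. w \<bullet> x = 0"
      using span_not_UNIV_orthogonal by blast
    define W where "W = {x. \<forall>b\<in>B. x \<bullet> b = 0}"
    have "subspace W" by (auto simp: W_def subspace_def inner_simps)
    moreover have "T ` W \<subseteq> W"
    proof (clarsimp simp: W_def)
      fix x b assume x: "\<forall>b\<in>B. x \<bullet> b = 0" and b: "b \<in> B"
      then obtain l where "T b = l *\<^sub>R b" using B by (auto simp: eigen_system_def)
      then show "T x \<bullet> b = 0" using T(2)[of x b] x b by simp
    qed
    moreover have "w \<in> W" using w by (auto simp: W_def span_base)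
    ultimately obtain v where v: "v \<in> W" "norm v = 1" "\<exists>l. T v = l *\<^sub>R v"
      using self_adjoint_eigenvector_in_subspace[OF T] w(1) by blast
    have "v \<notin> B" using v by (auto simp: W_def norm_eq_1)
    moreover have "eigen_system T (insert v B)"
      using B v by (auto simp: eigen_system_def pairwise_insert orthogonal_def W_def inner_commute)
    ultimately show False using max[of "insert v B"] fin[OF B] by simp
  qed
  then have "card B = DIM('a)"
    using eigen_system_independent[OF B] by (metis dim_UNIV dim_eq_card_independent dim_span)
  then show ?thesis using B fin by blast
qed

lemma symmetric_matrix_eigenbasis:
  fixes P :: "real ^ 'k ^ 'k"
  assumes "transpose P = P"
  obtains v :: "'k \<Rightarrow> real ^ 'k" and l :: "'k \<Rightarrow> real"
  where "\<And>i j. v i \<bullet> v j = (if i = j then 1 else 0)" and "\<And>i. P *v v i = l i *\<^sub>R v i"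
    and "\<And>x. x = (\<Sum>i\<in>UNIV. (x \<bullet> v i) *\<^sub>R v i)"
proof -
  have "(P *v x) \<bullet> y = x \<bullet> (P *v y)" for x y
    by (metis assms dot_lmul_matrix vector_transpose_matrix)
  then obtain B where B: "eigen_system ((*v) P) B" "finite B" "card B = CARD('k)"
    using spectral_theorem_self_adjoint[of "(*v) P"] by (auto simp: DIM_cart)
  then obtain v :: "'k \<Rightarrow> real ^ 'k" where v: "bij_betw v UNIV B"
    using finite_same_card_bij[of "UNIV :: 'k set" B] by auto
  have vB: "v i \<in> B" for i using v by (auto simp: bij_betw_def)
  then have "\<forall>i. \<exists>l. P *v v i = l *\<^sub>R v i" using B by (auto simp: eigen_system_def)
  then obtain l where l: "\<And>i. P *v v i = l i *\<^sub>R v i" by metis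
  have inj: "v i = v j \<longleftrightarrow> i = j" for i j using v by (auto simp: bij_betw_def inj_def)
  have ortho: "v i \<bullet> v j = (if i = j then 1 else 0)" for i j
    using B(1) vB[of i] vB[of j] inj[of i j]
    by (auto simp: eigen_system_def pairwise_def orthogonal_def norm_eq_1)
  have ind: "independent B" by (rule eigen_system_independent[OF B(1)])
  have "span B = UNIV"
    using card_ge_dim_independent[OF subset_UNIV ind] B by (auto simp: DIM_cart)
  then have "x = (\<Sum>i\<in>UNIV. (x \<bullet> v i) *\<^sub>R v i)" for x
    using orthonormal_basis_expand[of B x] B
      sum.reindex_bij_betw[OF v, of "\<lambda>b. (x \<bullet> b) *\<^sub>R b"]
    by (auto simp: eigen_system_def)
  with ortho l that show ?thesis by blast
qed

text \<open>
  The similarity \<open>P V = V L\<close> with the matrix \<open>V\<close> of eigenvectors is lifted to polynomial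
  matrices, where determinants are multiplicative as well. This links the roots of
  \<open>charpoly\<close>, counted with multiplicity, to the eigenbasis.
\<close>

lemma charpoly_eigenbasis:
  fixes P :: "real ^ 'k ^ 'k" and v :: "'k \<Rightarrow> real ^ 'k"
  assumes ortho: "\<And>i j. v i \<bullet> v j = (if i = j then 1 else 0)"
    and eig: "\<And>i. P *v v i = l i *\<^sub>R v i"
  shows "charpoly P = (\<Prod>i\<in>UNIV. [:- l i, 1:])"
proof -
  let ?C = "\<lambda>A :: real ^ 'k ^ 'k. (\<chi> i j. [:A $ i $ j:])"
  define V where "V = (\<chi> i j. v j $ i)"
  define L where "L = (\<chi> i j. if i = j then [:- l i, 1:] else 0)"
  have C_mult: "?C (A ** B) = ?C A ** ?C B" for A B :: "real ^ 'k ^ 'k"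
    by (simp add: matrix_matrix_mult_def vec_eq_iff sum_to_poly mult.commute)
  have VV: "transpose V ** V = mat 1"
    using ortho by (simp add: V_def matrix_matrix_mult_def transpose_def mat_def vec_eq_iff inner_vec_def)
  then have VV': "V ** transpose V = mat 1"
    using matrix_left_right_inverse by blast
  have PV: "P ** V = V ** (\<chi> i j. if i = j then l i else 0)"
  proof -
    have "(P ** V) $ i $ j = (P *v v j) $ i" for i j
      by (simp add: V_def matrix_matrix_mult_def matrix_vector_mult_def)
    then show ?thesis
      by (simp add: vec_eq_iff eig)
        (simp add: matrix_matrix_mult_def V_def if_distrib[of "(*) _"] mult.commute cong: if_cong)
  qed
  have diff: "(A - B) ** X = A ** X - B ** X" "X ** (A - B) = X ** A - X ** B"
    for A B X :: "real poly ^ 'k ^ 'k"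
    by (simp_all add: matrix_matrix_mult_def vec_eq_iff algebra_simps sum_subtractf)
  have "(mat [:0, 1:] - ?C P) ** ?C V = ?C V ** L"
  proof -
    have "mat [:0, 1:] ** ?C V = ?C V ** mat [:0, 1:]"
      by (simp add: matrix_matrix_mult_def mat_def vec_eq_iff if_distrib[of "(*) _"]
            if_distrib[of "\<lambda>x. x * _"] mult.commute cong: if_cong)
    moreover have "L = mat [:0, 1:] - ?C (\<chi> i j. if i = j then l i else 0)"
      by (simp add: L_def mat_def vec_eq_iff)
    ultimately show ?thesis
      by (simp only: diff C_mult[symmetric] PV)
  qed
  then have "det (mat [:0, 1:] - ?C P) * det (?C V) = det (?C V) * det L"
    by (simp only: det_mul[symmetric])
  moreover have "det (?C V) \<noteq> 0"
  proof -
    have "?C V ** ?C (transpose V) = ?C (mat 1)"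
      by (simp only: C_mult[symmetric] VV')
    also have "\<dots> = mat 1"
      by (simp add: mat_def vec_eq_iff)
    finally have "?C V ** ?C (transpose V) = mat 1" .
    then have "det (?C V) * det (?C (transpose V)) = 1"
      by (simp only: det_mul[symmetric] det_I)
    then show ?thesis by (metis mult_zero_left zero_neq_one)
  qed
  ultimately have "charpoly P = det L"
    unfolding charpoly_def by (metis mult.commute mult_cancel_left)
  also have "det L = (\<Prod>i\<in>UNIV. [:- l i, 1:])"
    by (subst det_diagonal) (simp_all add: L_def)
  finally show ?thesis .
qed

text \<open>
  The index \<open>i\<^sub>0\<close> is that of the head of the list sorted by decreasing magnitude. Removing
  one occurrence from the multiset of roots accounts for eigenvalues of higher multiplicity.
\<close>

lemma eigenvalues_below_second:
  fixes P :: "real ^ 'k ^ 'k" and l :: "'k \<Rightarrow> real"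
  assumes card: "CARD('k) > 1" and cp: "charpoly P = (\<Prod>i\<in>UNIV. [:- l i, 1:])"
  shows "\<exists>i\<^sub>0. \<forall>i. i \<noteq> i\<^sub>0 \<longrightarrow> \<bar>l i\<bar> \<le> \<bar>eigenvalue_mag 2 P\<bar>"
proof -
  define xs where "xs = rev (sort_key abs (sorted_list_of_multiset (proots (charpoly P))))"
  have roots: "proots (charpoly P) = image_mset l (mset_set UNIV)"
    unfolding cp by (subst proots_prod) (auto simp: sum_unfold_sum_mset)
  then have mset: "mset xs = image_mset l (mset_set UNIV)"
    by (simp add: xs_def)
  have "size (mset xs) = size (image_mset l (mset_set UNIV))"
    by (simp only: mset)
  then have "length xs = CARD('k)"
    by simp
  then obtain a b ys where xs: "xs = a # b # ys"
    using card by (cases xs; cases "tl xs") auto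
  have "sorted (rev (map abs xs))"
    by (simp add: xs_def rev_map[symmetric])
  then have le: "\<bar>x\<bar> \<le> \<bar>b\<bar>" if "x \<in> set (b # ys)" for x
    using that by (auto simp: xs sorted_append)
  have "a \<in># image_mset l (mset_set UNIV)"
    by (simp flip: mset add: xs)
  then obtain i\<^sub>0 where i0: "l i\<^sub>0 = a" by auto
  have "l i \<in> set (b # ys)" if "i \<noteq> i\<^sub>0" for i
  proof -
    have "mset_set (UNIV :: 'k set) = add_mset i\<^sub>0 (mset_set (UNIV - {i\<^sub>0}))"
      by (subst mset_set.remove[of UNIV i\<^sub>0]) auto
    with mset have "mset (b # ys) = image_mset l (mset_set (UNIV - {i\<^sub>0}))"
      by (simp add: xs i0)
    then have "set (b # ys) = l ` (UNIV - {i\<^sub>0})"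
      by (metis finite_Diff finite_UNIV finite_set_mset_mset_set set_image_mset set_mset_mset finite)
    then show ?thesis using that by blast
  qed
  moreover have "eigenvalue_mag 2 P = b"
    by (simp add: eigenvalue_mag_def flip: xs_def) (simp add: xs)
  ultimately show ?thesis using le by blast
qed

text \<open>
  In an eigenbasis, dropping the eigenvalue of largest magnitude leaves a form all of whose
  eigenvalues are at most \<open>\<bar>\<mu>\<^sub>2(P)\<bar>\<close> in magnitude.
\<close>

lemma symmetric_matrix_rank_one_approx:
  fixes P :: "real ^ 'k ^ 'k"
  assumes card: "CARD('k) > 1" and sym: "transpose P = P"
  shows "\<exists>l v. \<forall>x y. \<bar>x \<bullet> (P *v y) - l * (x \<bullet> v) * (y \<bullet> v)\<bar> \<le>
    \<bar>eigenvalue_mag 2 P\<bar> * norm x * norm y"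
proof -
  obtain v :: "'k \<Rightarrow> real ^ 'k" and l where ortho: "\<And>i j. v i \<bullet> v j = (if i = j then 1 else (0::real))"
    and eig: "\<And>i. P *v v i = l i *\<^sub>R v i" and expand: "\<And>x. x = (\<Sum>i\<in>UNIV. (x \<bullet> v i) *\<^sub>R v i)"
    by (rule symmetric_matrix_eigenbasis[OF sym]) (rule that)
  define m where "m = \<bar>eigenvalue_mag 2 P\<bar>"
  obtain i\<^sub>0 where i0: "\<And>i. i \<noteq> i\<^sub>0 \<Longrightarrow> \<bar>l i\<bar> \<le> m"
    using eigenvalues_below_second[OF card charpoly_eigenbasis[OF ortho eig]] by (auto simp: m_def)
  have "m \<ge> 0" by (simp add: m_def)
  have norm_expand: "L2_set (\<lambda>i. \<bar>x \<bullet> v i\<bar>) UNIV = norm x" for x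
  proof -
    have "x \<bullet> x = (\<Sum>i\<in>UNIV. (x \<bullet> v i)\<^sup>2)"
      by (subst (2) expand[of x]) (simp add: inner_sum_right power2_eq_square)
    then show ?thesis by (simp add: L2_set_def norm_eq_sqrt_inner)
  qed
  have "\<bar>x \<bullet> (P *v y) - l i\<^sub>0 * (x \<bullet> v i\<^sub>0) * (y \<bullet> v i\<^sub>0)\<bar> \<le> m * norm x * norm y" for x y
  proof -
    have "P *v y = (\<Sum>i\<in>UNIV. (y \<bullet> v i) *\<^sub>R (l i *\<^sub>R v i))"
      by (subst expand[of y]) (simp add: linear_sum[OF matrix_vector_mul_linear] matrix_vector_mult_scaleR eig)
    then have "x \<bullet> (P *v y) = (\<Sum>i\<in>UNIV. l i * (x \<bullet> v i) * (y \<bullet> v i))"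
      by (simp add: inner_sum_right ac_simps)
    also have "\<dots> = l i\<^sub>0 * (x \<bullet> v i\<^sub>0) * (y \<bullet> v i\<^sub>0) + (\<Sum>i\<in>UNIV - {i\<^sub>0}. l i * (x \<bullet> v i) * (y \<bullet> v i))"
      by (rule sum.remove) auto
    finally have "\<bar>x \<bullet> (P *v y) - l i\<^sub>0 * (x \<bullet> v i\<^sub>0) * (y \<bullet> v i\<^sub>0)\<bar> =
        \<bar>\<Sum>i\<in>UNIV - {i\<^sub>0}. l i * (x \<bullet> v i) * (y \<bullet> v i)\<bar>" by simp
    also have "\<dots> \<le> (\<Sum>i\<in>UNIV - {i\<^sub>0}. m * (\<bar>x \<bullet> v i\<bar> * \<bar>y \<bullet> v i\<bar>))"
      by (rule order_trans[OF sum_abs], rule sum_mono) (auto simp: abs_mult mult.assoc intro!: mult_right_mono i0)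
    also have "\<dots> \<le> (\<Sum>i\<in>UNIV. m * (\<bar>x \<bullet> v i\<bar> * \<bar>y \<bullet> v i\<bar>))"
      using \<open>m \<ge> 0\<close> by (intro sum_mono2) auto
    also have "\<dots> \<le> m * (norm x * norm y)"
      unfolding sum_distrib_left[symmetric] norm_expand[symmetric]
      using \<open>m \<ge> 0\<close> by (intro mult_left_mono order_trans[OF _ L2_set_mult_ineq]) auto
    finally show ?thesis by (simp add: mult.assoc)
  qed
  then show ?thesis unfolding m_def by blast
qed

text \<open>
  Write \<open>P \<approx> l v v'\<close> with error \<open>m = \<bar>\<mu>\<^sub>2(P)\<bar>\<close>. From \<open>u' P u = 1\<close>,
  \<open>l (v' u)\<^sup>2 \<ge> 1 - m \<ge> 1 / 2\<close>. From \<open>z' P u = 0\<close>, \<open>l (v' z) (v' u)\<close> is \<open>O(m)\<close>, and the same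
  holds for \<open>w\<close>. Multiplying these two bounds and dividing by \<open>l (v' u)\<^sup>2\<close> shows that
  \<open>l (v' z) (v' w)\<close> is \<open>O(m\<^sup>2)\<close>.
\<close>

lemma bilinear_small_on_complement:
  fixes P :: "real ^ 'k ^ 'k"
  assumes "CARD('k) > 1" "transpose P = P"
    and u: "u \<bullet> (P *v u) = 1" "norm u \<le> 1"
    and z: "z \<bullet> (P *v u) = 0" "w \<bullet> (P *v u) = 0"
    and m: "\<bar>eigenvalue_mag 2 P\<bar> \<le> 1 / 2"
  shows "\<bar>z \<bullet> (P *v w)\<bar> \<le> 2 * \<bar>eigenvalue_mag 2 P\<bar> * norm z * norm w"
proof -
  define m where "m = \<bar>eigenvalue_mag 2 P\<bar>"
  obtain l v where approx: "\<And>x y. \<bar>x \<bullet> (P *v y) - l * (x \<bullet> v) * (y \<bullet> v)\<bar> \<le> m * norm x * norm y"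
    using symmetric_matrix_rank_one_approx[OF assms(1,2)] unfolding m_def by blast
  have m: "0 \<le> m" "m \<le> 1 / 2" using m by (auto simp: m_def)
  have close: "\<bar>l * (x \<bullet> v) * (u \<bullet> v)\<bar> \<le> m * norm x" if "x \<bullet> (P *v u) = 0" for x
  proof -
    have "\<bar>l * (x \<bullet> v) * (u \<bullet> v)\<bar> \<le> m * norm x * norm u" using approx[of x u] that by simp
    also have "\<dots> \<le> m * norm x * 1" using m u by (intro mult_left_mono) auto
    finally show ?thesis by simp
  qed
  have "m * norm u * norm u \<le> 1 / 2 * 1 * 1"
    using m u by (intro mult_mono) auto
  then have large: "1 / 2 \<le> l * (u \<bullet> v)\<^sup>2"
    using approx[of u u] u by (simp add: power2_eq_square mult.assoc abs_le_iff)
  have "1 / 2 * \<bar>l * (z \<bullet> v) * (w \<bullet> v)\<bar> \<le> (l * (u \<bullet> v)\<^sup>2) * \<bar>l * (z \<bullet> v) * (w \<bullet> v)\<bar>"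
    by (intro mult_right_mono large) auto
  also have "\<dots> = \<bar>(l * (u \<bullet> v)\<^sup>2) * (l * (z \<bullet> v) * (w \<bullet> v))\<bar>"
    using large by (simp only: abs_mult[of "l * (u \<bullet> v)\<^sup>2"])
  also have "(l * (u \<bullet> v)\<^sup>2) * (l * (z \<bullet> v) * (w \<bullet> v)) =
      (l * (z \<bullet> v) * (u \<bullet> v)) * (l * (w \<bullet> v) * (u \<bullet> v))"
    by (simp only: power2_eq_square ac_simps)
  also have "\<bar>\<dots>\<bar> = \<bar>l * (z \<bullet> v) * (u \<bullet> v)\<bar> * \<bar>l * (w \<bullet> v) * (u \<bullet> v)\<bar>"
    by (rule abs_mult)
  also have "\<dots> \<le> (m * norm z) * (m * norm w)"
    using m by (intro mult_mono close z) auto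
  also have "\<dots> \<le> 1 / 2 * (m * norm z * norm w)"
    using m mult_right_mono[of m "1/2" "m * norm z * norm w"] by (simp add: ac_simps)
  finally show ?thesis
    using approx[of z w] unfolding m_def[symmetric] by (simp add: abs_le_iff)
qed

section \<open>The normalised connectivity matrix is close to all-ones\<close>

lemma pos_diagonal_sandwich:
  fixes P :: "real ^ 'k ^ 'k"
  assumes "pos_diagonal D"
  shows "(D ** P ** D) $ k $ l = D $ k $ k * P $ k $ l * D $ l $ l"
proof -
  define d where "d i = D $ i $ i" for i
  have D: "D $ i $ j = (if i = j then d i else 0)" for i j
    using assms by (auto simp: pos_diagonal_def d_def)
  have "(D ** P) $ k $ j = d k * P $ k $ j" for j
    by (simp add: matrix_matrix_mult_def D if_distrib[of "\<lambda>x. x * _"] cong: if_cong)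
  then show ?thesis
    by (simp add: matrix_matrix_mult_def[of "D ** P"] D if_distrib[of "(*) _"] cong: if_cong)
qed

text \<open>
  With \<open>u = D h\<close> one has \<open>P u = D\<inverse> 1\<close>, so the vectors \<open>z\<^sub>k = D (e\<^sub>k - h)\<close> are \<open>P\<close>-orthogonal
  to \<open>u\<close>, and \<open>z\<^sub>k' P z\<^sub>l = (D P D)\<^sub>k\<^sub>l - 1\<close>. The lengths are controlled because the diagonal
  term alone of \<open>D P D h = 1\<close> gives \<open>d\<^sub>k\<^sup>2 h\<^sub>k \<le> 1\<close>.
\<close>

lemma sandwich_near_one:
  fixes P D :: "real ^ 'k ^ 'k"
  assumes card: "CARD('k) > 1" and sym: "transpose P = P"
    and nonneg: "\<And>k l. 0 \<le> P $ k $ l" and diag: "\<And>k. P $ k $ k = 1"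
    and D: "pos_diagonal D" and fix_h: "(D ** P ** D) *v h = (\<chi> k. 1)"
    and C: "0 < C" "\<And>k. C \<le> h $ k" and h1: "(\<Sum>k\<in>UNIV. h $ k) = 1"
  shows "\<bar>(D ** P ** D) $ k $ l - 1\<bar> \<le> 2 * (1 + 1 / sqrt C)\<^sup>2 * \<bar>eigenvalue_mag 2 P\<bar>"
proof -
  define d where "d k = D $ k $ k" for k
  have d: "0 < d k" for k using D by (simp add: d_def pos_diagonal_def)
  note DPD = pos_diagonal_sandwich[OF D, of P, folded d_def]
  have h: "0 < h $ k" for k using C(1) C(2)[of k] by linarith
  have row: "(\<Sum>l\<in>UNIV. d k * P $ k $ l * d l * h $ l) = 1" for k
    using arg_cong[OF fix_h, of "\<lambda>x. x $ k"] by (simp add: matrix_vector_mult_def DPD)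
  have nn: "0 \<le> d k * P $ k $ l * d l" for k l
    by (intro mult_nonneg_nonneg nonneg less_imp_le[OF d])
  have entry: "d k * P $ k $ l * d l * h $ l \<le> 1" for k l
    unfolding row[of k, symmetric]
    by (intro member_le_sum[of l UNIV "\<lambda>l. d k * P $ k $ l * d l * h $ l"]
        mult_nonneg_nonneg nn less_imp_le[OF h]) auto
  have dh: "(d k)\<^sup>2 * h $ k \<le> 1" for k
    using entry[of k k] by (simp add: diag power2_eq_square)
  have d_le: "d k \<le> 1 / sqrt C" for k
  proof -
    have "(d k)\<^sup>2 * C \<le> 1"
      using dh[of k] C(2)[of k] mult_left_mono[of C "h $ k" "(d k)\<^sup>2"] by simp
    then have "(d k)\<^sup>2 \<le> (1 / sqrt C)\<^sup>2"
      using C(1) by (simp add: power_divide field_simps)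
    then show ?thesis by (rule power2_le_imp_le) (use C(1) in simp)
  qed
  define c where "c = 1 + 1 / sqrt C"
  have c1: "c \<ge> 1" using C(1) by (simp add: c_def)
  \<comment> \<open>For \<open>\<bar>\<mu>\<^sub>2(P)\<bar> > 1 / 2\<close> a bound on the entries of \<open>D P D\<close> is enough.\<close>
  show ?thesis
  proof (cases "\<bar>eigenvalue_mag 2 P\<bar> \<le> 1 / 2")
    case True
    define u where "u = (\<chi> k. d k * h $ k)"
    define z where "z k = d k *\<^sub>R axis k 1 - u" for k
    have Pu: "(P *v u) $ k = 1 / d k" for k
      using row[of k] d[of k]
      by (simp add: u_def matrix_vector_mult_def field_simps sum_distrib_left)
    have inner_u: "u \<bullet> (P *v u) = 1"
      using d h1 by (simp add: inner_vec_def Pu) (simp add: u_def less_imp_neq[OF d, symmetric])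
    have "(norm u)\<^sup>2 = (\<Sum>k\<in>UNIV. ((d k)\<^sup>2 * h $ k) * h $ k)"
      unfolding power2_norm_eq_inner inner_vec_def by (simp add: u_def power2_eq_square ac_simps)
    also have "\<dots> \<le> (\<Sum>k\<in>UNIV. 1 * h $ k)"
      using dh h by (intro sum_mono mult_right_mono) (auto intro: less_imp_le)
    finally have "(norm u)\<^sup>2 \<le> 1\<^sup>2" using h1 by simp
    then have norm_u: "norm u \<le> 1" by (rule power2_le_imp_le) simp
    have z_orth: "z k \<bullet> (P *v u) = 0" for k
      using d[of k] by (simp add: z_def inner_diff_left inner_u inner_axis' Pu)
    have norm_z: "norm (z k) \<le> c" for k
    proof -
      have "norm (z k) \<le> norm (d k *\<^sub>R axis k (1::real)) + norm u"
        unfolding z_def by (rule norm_triangle_ineq4)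
      also have "\<dots> \<le> 1 / sqrt C + 1"
        using d_le[of k] d[of k] norm_u by (simp add: norm_axis_1)
      finally show ?thesis by (simp add: c_def)
    qed
    have "z k \<bullet> (P *v z l) = z k \<bullet> (P *v (d l *\<^sub>R axis l 1))"
      by (simp add: z_def[of l] matrix_vector_mult_diff_distrib inner_diff_right z_orth)
    also have "\<dots> = d l * (d k * P $ k $ l - (u \<bullet> (P *v axis l 1)))"
      by (simp add: z_def matrix_vector_mult_scaleR inner_diff_left inner_axis' matrix_vector_mul_component inner_axis)
    also have "u \<bullet> (P *v axis l 1) = axis l 1 \<bullet> (P *v u)"
      by (metis dot_lmul_matrix inner_commute sym vector_transpose_matrix)
    also have "d l * (d k * P $ k $ l - axis l 1 \<bullet> (P *v u)) = (D ** P ** D) $ k $ l - 1"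
      using d[of l] by (simp add: inner_axis' Pu DPD algebra_simps)
    finally have "\<bar>(D ** P ** D) $ k $ l - 1\<bar> \<le> 2 * \<bar>eigenvalue_mag 2 P\<bar> * norm (z k) * norm (z l)"
      using bilinear_small_on_complement[OF card sym inner_u norm_u z_orth z_orth True, of k l] by simp
    also have "\<dots> \<le> 2 * \<bar>eigenvalue_mag 2 P\<bar> * c * c"
      using norm_z c1 by (intro mult_mono) auto
    finally show ?thesis by (simp add: c_def power2_eq_square ac_simps)
  next
    case False
    have "d k * P $ k $ l * d l * C \<le> d k * P $ k $ l * d l * h $ l"
      by (intro mult_left_mono C(2) nn)
    with entry[of k l] C(1) have "d k * P $ k $ l * d l \<le> 1 / C"
      by (simp add: field_simps)
    moreover note nn[of k l]
    moreover have "1 + 1 / C \<le> c\<^sup>2"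
      using C(1) by (simp add: c_def power2_sum power_divide)
    ultimately have "\<bar>(D ** P ** D) $ k $ l - 1\<bar> \<le> c\<^sup>2"
      using C(1) by (simp add: DPD abs_le_iff)
    also have "\<dots> \<le> c\<^sup>2 * (2 * \<bar>eigenvalue_mag 2 P\<bar>)"
      using False mult_left_mono[of 1 "2 * \<bar>eigenvalue_mag 2 P\<bar>" "c\<^sup>2"] by simp
    finally show ?thesis by (simp add: c_def ac_simps)
  qed
qed

section \<open>Centred membership profiles\<close>

text \<open>The integrand of \<open>h_tilde\<close>: the vector \<open>h\<^sub>i\<close> of the introduction.\<close>

definition profile :: "real ^ 'k ^ 'k \<Rightarrow> real ^ 'k \<Rightarrow> real ^ 'k" where
  "profile D x = (matrix_inv D *v x) /\<^sub>R l1_norm (matrix_inv D *v x)"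

lemma matrix_inv_pos_diagonal:
  fixes D :: "real ^ 'k ^ 'k"
  assumes "pos_diagonal D"
  shows "D *v (matrix_inv D *v x) = x" and "(matrix_inv D *v x) $ k = x $ k / D $ k $ k"
proof -
  define d where "d i = D $ i $ i" for i
  have d: "0 < d i" for i using assms by (simp add: d_def pos_diagonal_def)
  have D: "D $ i $ j = (if i = j then d i else 0)" for i j
    using assms by (auto simp: pos_diagonal_def d_def)
  define E where "E = (\<chi> i j. if i = j then 1 / d i else 0)"
  have "D ** E = mat 1" "E ** D = mat 1"
    using d by (simp_all add: vec_eq_iff matrix_matrix_mult_def D E_def mat_def
      if_distrib[of "\<lambda>x. x * _"] less_imp_neq[symmetric] cong: if_cong)
  then have "D ** matrix_inv D = mat 1 \<and> matrix_inv D ** D = mat 1"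
    unfolding matrix_inv_def by (rule_tac someI[of _ E]) simp
  then show inv: "D *v (matrix_inv D *v x) = x"
    by (simp add: matrix_vector_mul_assoc)
  have "(D *v (matrix_inv D *v x)) $ k = d k * (matrix_inv D *v x) $ k"
    by (simp add: matrix_vector_mult_def[of D] D if_distrib[of "\<lambda>x. x * _"] cong: if_cong)
  then show "(matrix_inv D *v x) $ k = x $ k / D $ k $ k"
    using d[of k] by (simp add: inv d_def field_simps)
qed

lemma l1_norm_pos_on_simplex:
  assumes "pos_diagonal D" and x: "x \<in> prob_simplex"
  shows "0 < l1_norm (matrix_inv D *v x)"
proof -
  have "\<exists>k. x $ k \<noteq> 0"
  proof (rule ccontr)
    assume "\<not> ?thesis"
    with x show False by (simp add: prob_simplex_def)
  qed
  then obtain k where "x $ k \<noteq> 0" by blast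
  moreover have "0 < D $ k $ k" using assms(1) by (simp add: pos_diagonal_def)
  ultimately have "0 < \<bar>(matrix_inv D *v x) $ k\<bar>"
    by (simp add: matrix_inv_pos_diagonal(2)[OF assms(1)])
  also have "\<dots> \<le> l1_norm (matrix_inv D *v x)"
    unfolding l1_norm_def by (rule member_le_sum) auto
  finally show ?thesis .
qed

lemma profile_in_simplex:
  assumes D: "pos_diagonal D" and x: "x \<in> prob_simplex"
  shows "profile D x \<in> prob_simplex"
proof -
  have nn: "0 \<le> (matrix_inv D *v x) $ k" for k
    using D x by (auto simp: matrix_inv_pos_diagonal[OF D] pos_diagonal_def prob_simplex_def
      intro!: divide_nonneg_pos)
  then have "l1_norm (matrix_inv D *v x) = (\<Sum>k\<in>UNIV. (matrix_inv D *v x) $ k)"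
    by (simp add: l1_norm_def)
  with nn l1_norm_pos_on_simplex[OF D x] show ?thesis
    by (simp add: profile_def prob_simplex_def sum_distrib_left[symmetric])
qed

text \<open>
  The factors \<open>\<parallel>D\<inverse>\<pi>\<^sub>i\<parallel>\<^sub>1\<close> in \<open>theta_tilde\<close> normalise \<open>D\<inverse>\<pi>\<^sub>i\<close>, which moves \<open>D\<close> into the form.
\<close>

lemma Omega_alt_profile:
  assumes D: "pos_diagonal D" and x: "\<pi> i \<in> prob_simplex" "\<pi> j \<in> prob_simplex"
  shows "Omega_alt \<theta> P D \<pi> i j =
    \<theta> i * \<theta> j * (profile D (\<pi> i) \<bullet> ((D ** P ** D) *v profile D (\<pi> j)))"
proof -
  have "D $ j $ i = D $ i $ j" for i j
    using D by (cases "i = j") (auto simp: pos_diagonal_def)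
  then have "transpose D = D"
    by (simp add: vec_eq_iff transpose_def)
  then have sym: "x \<bullet> (D *v y) = (D *v x) \<bullet> y" for x y
    by (metis dot_lmul_matrix vector_transpose_matrix)
  define a where "a i = l1_norm (matrix_inv D *v \<pi> i)" for i
  have a: "D *v profile D (\<pi> i) = \<pi> i /\<^sub>R a i" for i
    by (simp add: profile_def matrix_vector_mult_scaleR matrix_inv_pos_diagonal[OF D] a_def)
  have "profile D (\<pi> i) \<bullet> ((D ** P ** D) *v profile D (\<pi> j)) = (\<pi> i /\<^sub>R a i) \<bullet> (P *v (\<pi> j /\<^sub>R a j))"
    by (simp add: matrix_vector_mul_assoc[symmetric] sym a)
  then show ?thesis
    by (simp add: Omega_alt_def theta_tilde_def a_def matrix_vector_mult_scaleR divide_inverse)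
qed

lemma simplex_bounds:
  assumes "x \<in> prob_simplex"
  shows "0 \<le> x $ k" "x $ k \<le> 1" "norm x \<le> 1"
proof -
  have nn: "\<And>k. 0 \<le> x $ k" and s: "(\<Sum>k\<in>UNIV. x $ k) = 1"
    using assms by (auto simp: prob_simplex_def)
  show "0 \<le> x $ k" by (rule nn)
  show "x $ k \<le> 1" unfolding s[symmetric] using nn by (intro member_le_sum) auto
  show "norm x \<le> 1"
    using norm_le_l1_cart[of x] nn s by simp
qed

lemma profile_measurable: "profile D \<in> borel_measurable borel"
  for D :: "real ^ 'k ^ 'k"
proof -
  have lin: "(\<lambda>x. matrix_inv D *v x) \<in> borel_measurable borel"
    by (intro borel_measurable_continuous_onI linear_continuous_on matrix_vector_mul_bounded_linear)
  have "(\<lambda>x. l1_norm x) \<in> borel_measurable (borel :: (real ^ 'k) measure)"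
    unfolding l1_norm_def by (intro borel_measurable_continuous_onI continuous_intros)
  then have "(\<lambda>x. l1_norm (matrix_inv D *v x)) \<in> borel_measurable borel"
    using lin by simp
  then show ?thesis
    unfolding profile_def[abs_def] using lin by (intro borel_measurable_scaleR borel_measurable_inverse)
qed

lemma h_tilde_mean_profile:
  fixes F :: "(real ^ 'k) measure"
  assumes F: "prob_space F" "sets F = sets borel" "AE x in F. x \<in> prob_simplex"
    and D: "pos_diagonal D"
  shows "h_tilde F D \<in> prob_simplex"
    and "(\<integral>x. (profile D x - h_tilde F D) $ k \<partial>F) = 0"
proof -
  interpret prob_space F by fact
  have m: "profile D \<in> borel_measurable F"
    using profile_measurable by (simp add: measurable_cong_sets[OF F(2) refl])
  have AE: "AE x in F. profile D x \<in> prob_simplex"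
    using F(3) by eventually_elim (rule profile_in_simplex[OF D])
  have int: "integrable F (profile D)"
    by (rule integrable_const_bound[of _ 1, OF eventually_mono[OF AE] m]) (rule simplex_bounds)
  have h: "h_tilde F D = (\<integral>x. profile D x \<partial>F)"
    by (simp add: h_tilde_def profile_def)
  have comp: "integrable F (\<lambda>x. profile D x $ k)" "(\<integral>x. profile D x $ k \<partial>F) = h_tilde F D $ k" for k
    using integrable_bounded_linear[OF bounded_linear_vec_nth int, of k]
      integral_bounded_linear[OF bounded_linear_vec_nth int, of k] by (simp_all add: h)
  have "0 \<le> h_tilde F D $ k" for k
    unfolding comp(2)[symmetric]
    by (rule integral_nonneg_AE) (use AE in \<open>auto simp: prob_simplex_def elim: eventually_mono\<close>)
  moreover have "(\<Sum>k\<in>UNIV. h_tilde F D $ k) = 1"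
  proof -
    have "(\<Sum>k\<in>UNIV. h_tilde F D $ k) = (\<integral>x. (\<Sum>k\<in>UNIV. profile D x $ k) \<partial>F)"
      by (subst Bochner_Integration.integral_sum) (simp_all add: comp)
    also have "\<dots> = (\<integral>x. 1 \<partial>F)"
      using AE comp(1)
      by (intro integral_cong_AE borel_measurable_sum borel_measurable_integrable)
        (auto simp: prob_simplex_def elim: eventually_mono)
    finally show ?thesis by (simp add: prob_space)
  qed
  ultimately show "h_tilde F D \<in> prob_simplex" by (simp add: prob_simplex_def)
  show "(\<integral>x. (profile D x - h_tilde F D) $ k \<partial>F) = 0"
    using comp[of k] by (simp add: prob_space)
qed

text \<open>
  Since \<open>Q h = 1\<close>, all mixed terms of \<open>x = h + (x - h)\<close> and \<open>y = h + (y - h)\<close> are sums of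
  coordinates, and these are 1 for points of the simplex and 0 for differences of such
  points. The latter also allows subtracting 1 from every entry of \<open>Q\<close>.
\<close>

lemma bilinear_centred:
  fixes Q :: "real ^ 'k ^ 'k"
  assumes sym: "transpose Q = Q" and fix_h: "Q *v h = (\<chi> k. 1)"
    and "h \<in> prob_simplex" "x \<in> prob_simplex" "y \<in> prob_simplex"
  shows "x \<bullet> (Q *v y) = 1 + (\<Sum>k\<in>UNIV. \<Sum>l\<in>UNIV. (Q $ k $ l - 1) * (x - h) $ k * (y - h) $ l)"
proof -
  have one: "(\<chi> k. 1) \<bullet> z = (\<Sum>k\<in>UNIV. z $ k)" "z \<bullet> (\<chi> k. 1) = (\<Sum>k\<in>UNIV. z $ k)" for z :: "real ^ 'k"
    by (simp_all add: inner_vec_def)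
  have sums: "(\<Sum>k\<in>UNIV. x $ k) = 1" "(\<Sum>k\<in>UNIV. y $ k) = 1" "(\<Sum>k\<in>UNIV. h $ k) = 1"
    using assms by (auto simp: prob_simplex_def)
  have hQ: "h \<bullet> (Q *v z) = (\<Sum>k\<in>UNIV. z $ k)" for z
    by (metis dot_lmul_matrix fix_h one(1) sym vector_transpose_matrix)
  have zero: "(\<Sum>k\<in>UNIV. (x - h) $ k) = 0" "(\<Sum>k\<in>UNIV. (y - h) $ k) = 0"
    unfolding vector_minus_component sum_subtractf sums by simp_all
  have "(\<Sum>k\<in>UNIV. \<Sum>l\<in>UNIV. (Q $ k $ l - 1) * (x - h) $ k * (y - h) $ l) =
      (\<Sum>k\<in>UNIV. \<Sum>l\<in>UNIV. (x - h) $ k * (Q $ k $ l * (y - h) $ l)) -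
      (\<Sum>k\<in>UNIV. \<Sum>l\<in>UNIV. (x - h) $ k * (y - h) $ l)"
    unfolding sum_subtractf[symmetric] by (intro sum.cong refl) (simp add: algebra_simps)
  also have "\<dots> = (x - h) \<bullet> (Q *v (y - h)) - (\<Sum>k\<in>UNIV. (x - h) $ k) * (\<Sum>l\<in>UNIV. (y - h) $ l)"
    by (simp only: inner_vec_def matrix_vector_mult_def vec_lambda_beta sum_distrib_left inner_real_def
        sum_product[symmetric])
  also have "\<dots> = (x - h) \<bullet> (Q *v (y - h))"
    by (simp only: zero mult_zero_left diff_0_right)
  also have "\<dots> = x \<bullet> (Q *v y) - 1"
    by (simp add: matrix_vector_mult_diff_distrib inner_diff_left inner_diff_right fix_h hQ one sums sum_subtractf)
  finally show ?thesis by simp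
qed

section \<open>Exponential moments of sums of independent bounded variables\<close>

lemma nn_integral_normal_density:
  assumes "0 < \<sigma>"
  shows "(\<integral>\<^sup>+g. ennreal (normal_density \<mu> \<sigma> g) \<partial>lborel) = 1"
  using assms by (subst nn_integral_eq_integral) auto

lemma gaussian_exp_moment:
  "(\<integral>\<^sup>+g. ennreal (std_normal_density g * exp (s * g)) \<partial>lborel) = ennreal (exp (s\<^sup>2 / 2))"
proof -
  have "std_normal_density g * exp (s * g) = exp (s\<^sup>2 / 2) * normal_density s 1 g" for g
    unfolding normal_density_def
    by (simp add: exp_add[symmetric] field_simps power2_eq_square)
  then have "(\<integral>\<^sup>+g. ennreal (std_normal_density g * exp (s * g)) \<partial>lborel) =
      (\<integral>\<^sup>+g. ennreal (exp (s\<^sup>2 / 2)) * ennreal (normal_density s 1 g) \<partial>lborel)"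
    by (simp add: ennreal_mult)
  then show ?thesis
    by (simp add: nn_integral_cmult nn_integral_normal_density)
qed

lemma gaussian_exp_square_moment:
  assumes "a < 1 / 2"
  shows "(\<integral>\<^sup>+g. ennreal (std_normal_density g * exp (a * g\<^sup>2)) \<partial>lborel) =
    ennreal (1 / sqrt (1 - 2 * a))"
proof -
  define \<sigma> where "\<sigma> = 1 / sqrt (1 - 2 * a)"
  have \<sigma>: "0 < \<sigma>" "\<sigma>\<^sup>2 = 1 / (1 - 2 * a)"
    using assms by (simp_all add: \<sigma>_def power_divide)
  have "std_normal_density g * exp (a * g\<^sup>2) = \<sigma> * normal_density 0 \<sigma> g" for g
  proof -
    have "- g\<^sup>2 / 2 + a * g\<^sup>2 = - g\<^sup>2 / (2 * \<sigma>\<^sup>2)"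
      using assms by (simp add: \<sigma>(2) field_simps)
    moreover have "sqrt (2 * pi * \<sigma>\<^sup>2) = \<sigma> * sqrt (2 * pi)"
      using \<sigma>(1) by (simp add: real_sqrt_mult)
    ultimately show ?thesis
      using \<sigma>(1) by (simp add: normal_density_def exp_add[symmetric] field_simps)
  qed
  then have "(\<integral>\<^sup>+g. ennreal (std_normal_density g * exp (a * g\<^sup>2)) \<partial>lborel) =
      (\<integral>\<^sup>+g. ennreal \<sigma> * ennreal (normal_density 0 \<sigma> g) \<partial>lborel)"
    using \<sigma>(1) by (simp add: ennreal_mult)
  then show ?thesis
    using \<sigma>(1) by (simp add: nn_integral_cmult nn_integral_normal_density \<sigma>_def)
qed

text \<open>
  Hoeffding's lemma for an interval of length 2, with both signs of \<open>t\<close>.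
\<close>

lemma (in prob_space) bounded_centred_exp_moment:
  assumes [measurable]: "u \<in> borel_measurable M"
    and "AE x in M. \<bar>u x\<bar> \<le> 1" and "expectation u = 0"
  shows "(\<integral>\<^sup>+x. ennreal (exp (t * u x)) \<partial>M) \<le> ennreal (exp (t\<^sup>2 / 2))"
proof -
  have pos: "(\<integral>\<^sup>+x. ennreal (exp (s * v x)) \<partial>M) \<le> ennreal (exp (s\<^sup>2 / 2))"
    if "s > 0" "v \<in> borel_measurable M" "AE x in M. \<bar>v x\<bar> \<le> 1" "expectation v = 0" for s v
  proof -
    interpret interval_bounded_random_variable M v "-1" 1
      using that by unfold_locales (auto simp: abs_le_iff elim: eventually_mono)
    show ?thesis
      using Hoeffdings_lemma_nn_integral_0[OF that(1,4)] by simp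
  qed
  consider "t > 0" | "t = 0" | "t < 0" by linarith
  then show ?thesis
  proof cases
    case 1
    then show ?thesis using pos[of t u] assms by simp
  next
    case 2
    then show ?thesis by (simp add: emeasure_space_1)
  next
    case 3
    then show ?thesis using pos[of "-t" "\<lambda>x. - u x"] assms by simp
  qed
qed

lemma (in prob_space) iid_exp_linear_moment:
  fixes b :: "'i \<Rightarrow> real"
  assumes u[measurable]: "u \<in> borel_measurable M"
    and "AE x in M. \<bar>u x\<bar> \<le> 1" and "expectation u = 0" and "finite I"
  shows "(\<integral>\<^sup>+x. ennreal (exp (t * (\<Sum>i\<in>I. b i * u (x i)))) \<partial>(\<Pi>\<^sub>M i\<in>I. M)) \<le>
    ennreal (exp (t\<^sup>2 * (\<Sum>i\<in>I. (b i)\<^sup>2) / 2))"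
proof -
  interpret product_sigma_finite "\<lambda>_ :: 'i. M" ..
  have "(\<integral>\<^sup>+x. ennreal (exp (t * (\<Sum>i\<in>I. b i * u (x i)))) \<partial>(\<Pi>\<^sub>M i\<in>I. M)) =
      (\<integral>\<^sup>+x. (\<Prod>i\<in>I. ennreal (exp (t * b i * u (x i)))) \<partial>(\<Pi>\<^sub>M i\<in>I. M))"
    using \<open>finite I\<close> by (simp add: prod_ennreal exp_sum sum_distrib_left mult.assoc)
  also have "\<dots> = (\<Prod>i\<in>I. \<integral>\<^sup>+y. ennreal (exp (t * b i * u y)) \<partial>M)"
    using \<open>finite I\<close> by (subst product_nn_integral_prod) auto
  also have "\<dots> \<le> (\<Prod>i\<in>I. ennreal (exp ((t * b i)\<^sup>2 / 2)))"
    using assms by (intro prod_mono_ennreal bounded_centred_exp_moment) auto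
  also have "\<dots> = ennreal (exp (t\<^sup>2 * (\<Sum>i\<in>I. (b i)\<^sup>2) / 2))"
    using \<open>finite I\<close>
    by (simp add: prod_ennreal exp_sum[symmetric] sum_distrib_left sum_divide_distrib power_mult_distrib)
  finally show ?thesis .
qed

text \<open>
  Gaussian linearisation: \<open>exp (\<tau> Y\<^sup>2)\<close> is the mean of \<open>exp (sqrt (2 \<tau>) g Y)\<close> over a standard
  Gaussian \<open>g\<close>. Exchanging the integrals leaves an exponential moment of a sum of independent
  terms inside.
\<close>

lemma (in prob_space) iid_exp_square_moment:
  fixes b :: "'i \<Rightarrow> real"
  assumes u[measurable]: "u \<in> borel_measurable M"
    and "AE x in M. \<bar>u x\<bar> \<le> 1" and "expectation u = 0" and "finite I"
    and "0 \<le> \<tau>" and "2 * \<tau> * (\<Sum>i\<in>I. (b i)\<^sup>2) < 1"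
  shows "(\<integral>\<^sup>+x. ennreal (exp (\<tau> * (\<Sum>i\<in>I. b i * u (x i))\<^sup>2)) \<partial>(\<Pi>\<^sub>M i\<in>I. M)) \<le>
    ennreal (1 / sqrt (1 - 2 * \<tau> * (\<Sum>i\<in>I. (b i)\<^sup>2)))"
proof -
  define Y where "Y x = (\<Sum>i\<in>I. b i * u (x i))" for x
  \<comment> \<open>This scaling makes the Gaussian average of \<open>exp (s * Y * g)\<close> equal to \<open>exp (\<tau> * Y\<^sup>2)\<close>.\<close>
  define s where "s = sqrt (2 * \<tau>)"
  interpret P: prob_space "\<Pi>\<^sub>M i\<in>I. M" by (rule prob_space_PiM) unfold_locales
  interpret pair_sigma_finite "\<Pi>\<^sub>M i\<in>I. M" "lborel :: real measure" ..
  have Y[measurable]: "Y \<in> borel_measurable (\<Pi>\<^sub>M i\<in>I. M)"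
    unfolding Y_def by measurable
  have s: "s\<^sup>2 = 2 * \<tau>" using assms(5) by (simp add: s_def)
  have "(\<integral>\<^sup>+x. ennreal (exp (\<tau> * (Y x)\<^sup>2)) \<partial>(\<Pi>\<^sub>M i\<in>I. M)) =
      (\<integral>\<^sup>+x. \<integral>\<^sup>+g. ennreal (std_normal_density g * exp (s * Y x * g)) \<partial>lborel \<partial>(\<Pi>\<^sub>M i\<in>I. M))"
    by (simp add: gaussian_exp_moment power_mult_distrib s)
  also have "\<dots> =
      (\<integral>\<^sup>+g. \<integral>\<^sup>+x. ennreal (std_normal_density g * exp (s * Y x * g)) \<partial>(\<Pi>\<^sub>M i\<in>I. M) \<partial>lborel)"
    by (rule Fubini'[symmetric]) measurable
  also have "\<dots> = (\<integral>\<^sup>+g. ennreal (std_normal_density g) *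
      (\<integral>\<^sup>+x. ennreal (exp ((s * g) * Y x)) \<partial>(\<Pi>\<^sub>M i\<in>I. M)) \<partial>lborel)"
    by (simp add: ennreal_mult nn_integral_cmult ac_simps)
  also have "\<dots> \<le> (\<integral>\<^sup>+g. ennreal (std_normal_density g) *
      ennreal (exp ((s * g)\<^sup>2 * (\<Sum>i\<in>I. (b i)\<^sup>2) / 2)) \<partial>lborel)"
    using assms unfolding Y_def by (intro nn_integral_mono mult_left_mono iid_exp_linear_moment) auto
  also have "\<dots> = (\<integral>\<^sup>+g. ennreal (std_normal_density g *
      exp ((\<tau> * (\<Sum>i\<in>I. (b i)\<^sup>2)) * g\<^sup>2)) \<partial>lborel)"
    by (simp add: ennreal_mult power_mult_distrib s ac_simps)
  also have "\<dots> = ennreal (1 / sqrt (1 - 2 * \<tau> * (\<Sum>i\<in>I. (b i)\<^sup>2)))"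
    using assms by (subst gaussian_exp_square_moment) (auto simp: mult.assoc)
  finally show ?thesis by (simp add: Y_def)
qed

text \<open>
  Jensen's inequality for the exponential and countably many weights. It is stated through a
  summable minorant \<open>f\<close> of \<open>w s * Z s\<close> because the sum of the \<open>f s\<close> is the quantity in the
  exponent to be bounded.
\<close>

lemma exp_sums_le:
  fixes w Z f :: "nat \<Rightarrow> real"
  assumes "w sums 1" and "\<And>s. 0 \<le> w s" and "f sums S" and "\<And>s. f s \<le> w s * Z s"
  shows "ennreal (exp S) \<le> (\<Sum>s. ennreal (w s * exp (Z s)))"
proof -
  have "(\<lambda>s. exp S * (w s * (1 - S) + f s)) sums (exp S * (1 * (1 - S) + S))"
    using assms(1,3) by (intro sums_mult sums_add sums_mult2)
  then have lim: "(\<lambda>N. ennreal (\<Sum>s<N. exp S * (w s * (1 - S) + f s))) \<longlonglongrightarrow> ennreal (exp S)"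
    unfolding sums_def by (intro tendsto_ennrealI) simp
  \<comment> \<open>The graph of \<open>exp\<close> lies above its tangent at \<open>S\<close>.\<close>
  have tangent: "exp S * (w s * (1 - S) + f s) \<le> w s * exp (Z s)" for s
  proof -
    have "exp S * (w s * (1 - S) + f s) \<le> exp S * (w s * (1 + (Z s - S)))"
      using assms(4)[of s] by (intro mult_left_mono) (auto simp: algebra_simps)
    also have "\<dots> \<le> exp S * (w s * exp (Z s - S))"
      using assms(2)[of s] by (intro mult_left_mono exp_ge_add_one_self) auto
    also have "\<dots> = w s * exp (Z s)"
      by (simp add: exp_diff)
    finally show ?thesis .
  qed
  have "ennreal (\<Sum>s<N. exp S * (w s * (1 - S) + f s)) \<le> (\<Sum>s. ennreal (w s * exp (Z s)))" for N
  proof -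
    have "ennreal (\<Sum>s<N. exp S * (w s * (1 - S) + f s)) \<le> ennreal (\<Sum>s<N. w s * exp (Z s))"
      by (intro ennreal_leI sum_mono tangent)
    also have "\<dots> = (\<Sum>s<N. ennreal (w s * exp (Z s)))"
      using assms(2) by simp
    also have "\<dots> \<le> (\<Sum>s. ennreal (w s * exp (Z s)))"
      by (rule sum_le_suminf) auto
    finally show ?thesis .
  qed
  then show ?thesis
    by (intro LIMSEQ_le_const2[OF lim]) auto
qed

section \<open>Exponential moments of the two-replica quadratic form\<close>

text \<open>The pairs above the diagonal, the index set of the independent coins in \<open>adjacency_pmf\<close>.\<close>

definition edges :: "nat \<Rightarrow> (nat \<times> nat) set" where
  "edges n = {(i, j). i < j \<and> j < n}"

lemma finite_edges[simp]: "finite (edges n)"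
  by (rule finite_subset[of _ "{..<n} \<times> {..<n}"]) (auto simp: edges_def)

lemma sum_edges_Suc:
  "(\<Sum>(i, j)\<in>edges (Suc n). s i j) = (\<Sum>(i, j)\<in>edges n. s i j) + (\<Sum>i<n. s i n)"
proof -
  have "edges (Suc n) = edges n \<union> (\<lambda>i. (i, n)) ` {..<n}"
    by (auto simp: edges_def)
  moreover have "edges n \<inter> (\<lambda>i. (i, n)) ` {..<n} = {}"
    by (auto simp: edges_def)
  ultimately show ?thesis
    by (simp add: sum.union_disjoint sum.reindex inj_on_def)
qed

lemma sum_symmetric_square:
  fixes s :: "nat \<Rightarrow> nat \<Rightarrow> real"
  assumes "\<And>i j. s i j = s j i"
  shows "(\<Sum>i<n. \<Sum>j<n. s i j) = 2 * (\<Sum>(i, j)\<in>edges n. s i j) + (\<Sum>i<n. s i i)"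
proof (induction n)
  case 0
  then show ?case by (simp add: edges_def)
next
  case (Suc n)
  then show ?case
    using assms by (simp add: sum_edges_Suc sum.distrib)
qed

lemma quadratic_form_bound:
  fixes H :: "'p::finite \<Rightarrow> 'p \<Rightarrow> real"
  assumes "\<And>p q. \<bar>H p q\<bar> \<le> \<eta>"
  shows "\<bar>\<Sum>p\<in>UNIV. \<Sum>q\<in>UNIV. H p q * X p * X q\<bar> \<le> \<eta> * CARD('p) * (\<Sum>p\<in>UNIV. (X p)\<^sup>2)"
proof -
  have "\<eta> \<ge> 0" using assms[of undefined undefined] by linarith
  have "\<bar>\<Sum>p\<in>UNIV. \<Sum>q\<in>UNIV. H p q * X p * X q\<bar> \<le> (\<Sum>p\<in>UNIV. \<Sum>q\<in>UNIV. \<eta> * (\<bar>X p\<bar> * \<bar>X q\<bar>))"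
    by (rule order_trans[OF sum_abs], rule sum_mono, rule order_trans[OF sum_abs], rule sum_mono)
      (auto simp: abs_mult mult.assoc intro!: mult_right_mono assms)
  also have "\<dots> = \<eta> * (\<Sum>p\<in>UNIV. \<bar>X p\<bar>)\<^sup>2"
    by (simp only: power2_eq_square sum_product, simp only: sum_distrib_left)
  also have "(\<Sum>p\<in>UNIV. \<bar>X p\<bar>)\<^sup>2 \<le> CARD('p) * (\<Sum>p\<in>UNIV. (X p)\<^sup>2)"
    using sum_squared_le_sum_of_squares[of "\<lambda>p. \<bar>X p\<bar>" UNIV] by (simp add: mult.commute)
  finally show ?thesis using \<open>\<eta> \<ge> 0\<close> by (simp add: mult_left_mono mult.assoc)
qed

text \<open>
  The sum over pairs is half of the full double sum minus its diagonal, and the full double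
  sum is the form \<open>H\<close> evaluated at the vector \<open>\<Sum>\<^sub>i b\<^sub>i \<xi>\<^sub>i\<close>.
\<close>

lemma chaos_bound:
  fixes H :: "'p::finite \<Rightarrow> 'p \<Rightarrow> real" and \<xi> :: "nat \<Rightarrow> 'p \<Rightarrow> real" and b :: "nat \<Rightarrow> real"
  assumes sym: "\<And>p q. H p q = H q p" and H: "\<And>p q. \<bar>H p q\<bar> \<le> \<eta>"
    and \<xi>: "\<And>i p. i < n \<Longrightarrow> \<bar>\<xi> i p\<bar> \<le> 1"
  shows "(\<Sum>(i, j)\<in>edges n. b i * b j * (\<Sum>p\<in>UNIV. \<Sum>q\<in>UNIV. H p q * \<xi> i p * \<xi> j q)) \<le>
    \<eta> / 2 * (CARD('p) * (\<Sum>p\<in>UNIV. (\<Sum>i<n. b i * \<xi> i p)\<^sup>2) + (CARD('p))\<^sup>2 * (\<Sum>i<n. (b i)\<^sup>2))"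
proof -
  define s where "s i j = b i * b j * (\<Sum>p\<in>UNIV. \<Sum>q\<in>UNIV. H p q * \<xi> i p * \<xi> j q)" for i j
  have \<eta>: "\<eta> \<ge> 0" using H[of undefined undefined] by linarith
  have "s i j = s j i" for i j
    unfolding s_def by (subst sum.swap) (simp add: sym ac_simps)
  note square = sum_symmetric_square[of s n, OF this]
  have "(\<Sum>i<n. \<Sum>j<n. s i j) =
      (\<Sum>p\<in>UNIV. \<Sum>q\<in>UNIV. H p q * (\<Sum>i<n. b i * \<xi> i p) * (\<Sum>j<n. b j * \<xi> j q))"
  proof -
    have "(\<Sum>i<n. \<Sum>j<n. s i j) =
        (\<Sum>i<n. \<Sum>p\<in>UNIV. \<Sum>q\<in>UNIV. \<Sum>j<n. H p q * (b i * \<xi> i p) * (b j * \<xi> j q))"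
      unfolding s_def sum_distrib_left
      by (intro sum.cong refl, subst sum.swap, intro sum.cong refl, subst sum.swap, simp add: ac_simps)
    also have "\<dots> = (\<Sum>p\<in>UNIV. \<Sum>i<n. \<Sum>q\<in>UNIV. \<Sum>j<n. H p q * (b i * \<xi> i p) * (b j * \<xi> j q))"
      by (rule sum.swap)
    also have "\<dots> = (\<Sum>p\<in>UNIV. \<Sum>q\<in>UNIV. \<Sum>i<n. \<Sum>j<n. H p q * (b i * \<xi> i p) * (b j * \<xi> j q))"
      by (intro sum.cong refl sum.swap)
    finally show ?thesis
      by (simp only: mult.assoc sum_product, simp only: sum_distrib_left)
  qed
  then have all: "(\<Sum>i<n. \<Sum>j<n. s i j) \<le> \<eta> * CARD('p) * (\<Sum>p\<in>UNIV. (\<Sum>i<n. b i * \<xi> i p)\<^sup>2)"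
    using quadratic_form_bound[of H \<eta> "\<lambda>p. \<Sum>i<n. b i * \<xi> i p", OF H] by simp
  have "- s i i \<le> \<eta> * (CARD('p))\<^sup>2 * (b i)\<^sup>2" if "i < n" for i
  proof -
    have "(\<xi> i p)\<^sup>2 \<le> 1" for p
      using \<xi>[OF that, of p] by (simp add: abs_square_le_1)
    then have "(\<Sum>p\<in>UNIV. (\<xi> i p)\<^sup>2) \<le> (\<Sum>p\<in>(UNIV::'p set). 1)" by (intro sum_mono)
    then have "\<eta> * CARD('p) * (\<Sum>p\<in>UNIV. (\<xi> i p)\<^sup>2) \<le> \<eta> * CARD('p) * CARD('p)"
      using \<eta> by (intro mult_left_mono) auto
    with quadratic_form_bound[of H \<eta> "\<xi> i", OF H]
    have "\<bar>\<Sum>p\<in>UNIV. \<Sum>q\<in>UNIV. H p q * \<xi> i p * \<xi> i q\<bar> \<le> \<eta> * (CARD('p))\<^sup>2"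
      by (simp add: power2_eq_square mult.assoc)
    then have "(b i)\<^sup>2 * - (\<Sum>p\<in>UNIV. \<Sum>q\<in>UNIV. H p q * \<xi> i p * \<xi> i q) \<le> (b i)\<^sup>2 * (\<eta> * (CARD('p))\<^sup>2)"
      by (intro mult_left_mono) auto
    then show ?thesis by (simp add: s_def power2_eq_square ac_simps)
  qed
  then have "(\<Sum>i<n. - s i i) \<le> (\<Sum>i<n. \<eta> * (CARD('p))\<^sup>2 * (b i)\<^sup>2)"
    by (intro sum_mono) auto
  with all square have "2 * (\<Sum>(i, j)\<in>edges n. s i j) \<le> \<eta> * CARD('p) * (\<Sum>p\<in>UNIV. (\<Sum>i<n. b i * \<xi> i p)\<^sup>2)
      + \<eta> * (CARD('p))\<^sup>2 * (\<Sum>i<n. (b i)\<^sup>2)"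
    by (simp add: sum_negf sum_distrib_left)
  then show ?thesis by (simp add: s_def algebra_simps)
qed

text \<open>
  Convexity moves the average over \<open>p\<close> out of the exponential, so that each square can be
  treated by itself.
\<close>

lemma (in prob_space) exp_mixture_moment:
  fixes c :: "nat \<Rightarrow> 'p::finite \<Rightarrow> real" and y :: "'a \<Rightarrow> 'p \<Rightarrow> real"
  assumes y[measurable]: "\<And>p. (\<lambda>x. y x p) \<in> borel_measurable M"
    and "\<And>p. AE x in M. \<bar>y x p\<bar> \<le> 1" and "\<And>p. expectation (\<lambda>x. y x p) = 0"
    and c: "\<And>p. (\<Sum>i<n. (c i p)\<^sup>2) \<le> V" and \<tau>: "0 \<le> \<tau>" "2 * (\<tau> * V) < 1"
  shows "(\<integral>\<^sup>+x. ennreal (exp (\<epsilon> + (\<Sum>p\<in>UNIV. 1 / CARD('p) * (\<tau> * (\<Sum>i<n. c i p * y (x i) p)\<^sup>2))))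
      \<partial>(\<Pi>\<^sub>M i\<in>{..<n}. M)) \<le> ennreal (exp \<epsilon> / sqrt (1 - 2 * (\<tau> * V)))"
    (is "(\<integral>\<^sup>+x. ennreal (exp (\<epsilon> + (\<Sum>p\<in>UNIV. _ * ?Z x p))) \<partial>?M) \<le> _")
proof -
  have moment: "(\<integral>\<^sup>+x. ennreal (exp (?Z x p)) \<partial>?M) \<le> ennreal (1 / sqrt (1 - 2 * (\<tau> * V)))" for p
  proof -
    have le: "\<tau> * (\<Sum>i<n. (c i p)\<^sup>2) \<le> \<tau> * V"
      using \<tau>(1) by (intro mult_left_mono c)
    have "(\<integral>\<^sup>+x. ennreal (exp (?Z x p)) \<partial>?M) \<le> ennreal (1 / sqrt (1 - 2 * \<tau> * (\<Sum>i<n. (c i p)\<^sup>2)))"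
      using assms le by (intro iid_exp_square_moment) auto
    also have "\<dots> \<le> ennreal (1 / sqrt (1 - 2 * (\<tau> * V)))"
      using le \<tau> by (intro ennreal_leI divide_left_mono) (auto simp: mult.assoc)
    finally show ?thesis .
  qed
  have convex: "exp (\<Sum>p\<in>UNIV. 1 / CARD('p) * ?Z x p) \<le> (\<Sum>p\<in>UNIV. 1 / CARD('p) * exp (?Z x p))" for x
    by (rule convex_on_sum[of UNIV UNIV exp "\<lambda>_. 1 / CARD('p)" "?Z x", simplified scaleR_conv_of_real of_real_eq_id id_apply])
      (use convex_on_exp[of 1] in auto)
  have "(\<integral>\<^sup>+x. ennreal (exp (\<epsilon> + (\<Sum>p\<in>UNIV. 1 / CARD('p) * ?Z x p))) \<partial>?M) \<le>
      (\<integral>\<^sup>+x. (\<Sum>p\<in>UNIV. ennreal (exp \<epsilon> / CARD('p)) * ennreal (exp (?Z x p))) \<partial>?M)"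
  proof (intro nn_integral_mono)
    fix x
    have "exp (\<epsilon> + (\<Sum>p\<in>UNIV. 1 / CARD('p) * ?Z x p)) \<le> (\<Sum>p\<in>UNIV. exp \<epsilon> / CARD('p) * exp (?Z x p))"
      using mult_left_mono[OF convex[of x], of "exp \<epsilon>"] by (simp add: exp_add sum_distrib_left)
    then show "ennreal (exp (\<epsilon> + (\<Sum>p\<in>UNIV. 1 / CARD('p) * ?Z x p))) \<le>
        (\<Sum>p\<in>UNIV. ennreal (exp \<epsilon> / CARD('p)) * ennreal (exp (?Z x p)))"
      by (simp add: ennreal_leI flip: ennreal_mult)
  qed
  also have "\<dots> = (\<Sum>p\<in>UNIV. ennreal (exp \<epsilon> / CARD('p)) * (\<integral>\<^sup>+x. ennreal (exp (?Z x p)) \<partial>?M))"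
    by (simp add: nn_integral_sum nn_integral_cmult)
  also have "\<dots> \<le> (\<Sum>p\<in>(UNIV::'p set). ennreal (exp \<epsilon> / CARD('p)) * ennreal (1 / sqrt (1 - 2 * (\<tau> * V))))"
    by (intro sum_mono mult_left_mono moment) auto
  also have "\<dots> = ennreal (exp \<epsilon> / sqrt (1 - 2 * (\<tau> * V)))"
    using \<tau> by (simp add: ennreal_mult[symmetric] ennreal_of_nat_eq_real_of_nat)
  finally show ?thesis .
qed

text \<open>
  The vectors \<open>z\<^sub>i\<close> are those of the second replica, held fixed. The product of the two forms
  is one form with kernel \<open>G \<otimes> G\<close> in the products \<open>y\<^sub>i\<^sub>,\<^sub>k z\<^sub>i\<^sub>,\<^sub>l\<close>. The kernel
  \<open>\<theta>\<^sub>i \<theta>\<^sub>j / (1 - \<theta>\<^sub>i \<theta>\<^sub>j)\<close> is the sum of the rank one kernels \<open>\<theta>\<^sub>i\<^bsup>s+1\<^esup> \<theta>\<^sub>j\<^bsup>s+1\<^esup>\<close>. As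
  \<open>\<theta>\<^sub>i \<le> c\<close>, a factor \<open>c\<^bsup>2s\<^esup>\<close> can be taken out of the form for \<open>s\<close>, which provides the
  weights for Jensen's inequality.
\<close>

lemma (in prob_space) exp_chaos_moment:
  fixes G :: "'k::finite \<Rightarrow> 'k \<Rightarrow> real" and y :: "'a \<Rightarrow> 'k \<Rightarrow> real" and \<theta> :: "nat \<Rightarrow> real"
  assumes y[measurable]: "\<And>k. (\<lambda>x. y x k) \<in> borel_measurable M"
    and y1: "\<And>k. AE x in M. \<bar>y x k\<bar> \<le> 1" and y0: "\<And>k. expectation (\<lambda>x. y x k) = 0"
    and z1: "\<And>i k. i < n \<Longrightarrow> \<bar>z i k\<bar> \<le> 1"
    and sym: "\<And>k l. G k l = G l k" and G: "\<And>k l. \<bar>G k l\<bar> \<le> \<gamma>"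
    and \<theta>: "\<And>i. i < n \<Longrightarrow> 0 < \<theta> i" "\<And>i. i < n \<Longrightarrow> \<theta> i \<le> c" and c: "0 < c" "c < 1"
    and \<epsilon>: "\<epsilon> = \<gamma>\<^sup>2 * CARD('k) ^ 4 / (2 * (1 - c\<^sup>2)) * (\<Sum>i<n. (\<theta> i)\<^sup>2)" "2 * \<epsilon> < 1"
  shows "(\<integral>\<^sup>+x. ennreal (exp (\<Sum>(i, j)\<in>edges n. \<theta> i * \<theta> j / (1 - \<theta> i * \<theta> j) *
      ((\<Sum>k\<in>UNIV. \<Sum>l\<in>UNIV. G k l * y (x i) k * y (x j) l) * (\<Sum>k\<in>UNIV. \<Sum>l\<in>UNIV. G k l * z i k * z j l))))
      \<partial>(\<Pi>\<^sub>M i\<in>{..<n}. M)) \<le> ennreal (exp \<epsilon> / sqrt (1 - 2 * \<epsilon>))"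
    (is "(\<integral>\<^sup>+x. ennreal (exp (?S x)) \<partial>?M) \<le> _")
proof -
  define R where "R = real CARD('k \<times> 'k)"
  define \<tau> where "\<tau> = \<gamma>\<^sup>2 * R\<^sup>2 / (2 * (1 - c\<^sup>2))"
  define V where "V = (\<Sum>i<n. (\<theta> i)\<^sup>2)"
  have R: "0 < R" by (simp add: R_def)
  have c2: "c\<^sup>2 < 1" using c by (simp add: power_less_one_iff)
  have \<epsilon>_eq: "\<epsilon> = \<tau> * V" by (simp add: \<epsilon>(1) \<tau>_def R_def V_def power2_eq_square power4_eq_xxxx)
  have \<tau>: "0 \<le> \<tau>" "\<gamma>\<^sup>2 / 2 * R\<^sup>2 = (1 - c\<^sup>2) * \<tau>"
  proof -
    have "a / 2 = d * (a / (2 * d))" if "0 < d" for a d :: real using that by simp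
    from this[of "1 - c\<^sup>2" "\<gamma>\<^sup>2 * R\<^sup>2"] show "\<gamma>\<^sup>2 / 2 * R\<^sup>2 = (1 - c\<^sup>2) * \<tau>"
      using c2 by (simp add: \<tau>_def)
  qed (use c2 in \<open>simp add: \<tau>_def\<close>)
  \<comment> \<open>The geometric weights of the Jensen step, normalised to sum to 1.\<close>
  define w where "w s = (1 - c\<^sup>2) * (c ^ s)\<^sup>2" for s :: nat
  have w0: "0 \<le> w s" for s using c2 by (simp add: w_def)
  have "(\<lambda>s. (1 - c\<^sup>2) * (c\<^sup>2) ^ s) sums ((1 - c\<^sup>2) * (1 / (1 - c\<^sup>2)))"
    using c2 by (intro sums_mult geometric_sums) simp
  then have w1: "w sums 1"
    using c2 by (simp add: w_def[abs_def] power_mult[symmetric] mult.commute)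
  define H where "H = (\<lambda>(k, l) (k', l'). G k k' * G l l')"
  define \<xi> where "\<xi> x i = (\<lambda>(k, l). y (x i) k * z i l)" for x :: "nat \<Rightarrow> 'a" and i
  have H: "\<bar>H p q\<bar> \<le> \<gamma>\<^sup>2" "H p q = H q p" for p q
    using sym G by (auto simp: H_def abs_mult power2_eq_square split: prod.split intro!: mult_mono order_trans[OF abs_ge_zero G])
  define T where "T x i j = (\<Sum>p\<in>UNIV. \<Sum>q\<in>UNIV. H p q * \<xi> x i p * \<xi> x j q)" for x i j
  have T: "(\<Sum>k\<in>UNIV. \<Sum>l\<in>UNIV. G k l * y (x i) k * y (x j) l) * (\<Sum>k\<in>UNIV. \<Sum>l\<in>UNIV. G k l * z i k * z j l) = T x i j" for x i j
  proof -
    have pairs: "(\<Sum>p\<in>UNIV. g p) = (\<Sum>k\<in>UNIV. \<Sum>l\<in>UNIV. g (k, l))" for g :: "'k \<times> 'k \<Rightarrow> real"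
      by (simp add: sum.cartesian_product)
    have "T x i j = (\<Sum>k\<in>UNIV. \<Sum>l\<in>UNIV. \<Sum>k'\<in>UNIV. \<Sum>l'\<in>UNIV.
        (G k k' * y (x i) k * y (x j) k') * (G l l' * z i l * z j l'))"
      by (simp add: T_def H_def \<xi>_def pairs ac_simps)
    also have "\<dots> = (\<Sum>k\<in>UNIV. \<Sum>k'\<in>UNIV. \<Sum>l\<in>UNIV. \<Sum>l'\<in>UNIV.
        (G k k' * y (x i) k * y (x j) k') * (G l l' * z i l * z j l'))"
      by (intro sum.cong refl sum.swap)
    finally show ?thesis
      by (simp only: sum_distrib_right, simp only: sum_distrib_left)
  qed
  \<comment> \<open>The coefficients \<open>\<theta> i ^ Suc s\<close> without the factor \<open>c ^ s\<close> that goes into \<open>w s\<close>; they are bounded by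
    \<open>\<theta> i\<close> for every \<open>s\<close>.\<close>
  define b where "b s i = \<theta> i * (\<theta> i / c) ^ s" for s i
  define Y where "Y s x p = (\<Sum>i<n. (b s i * z i (snd p)) * y (x i) (fst p))" for s x p
  \<comment> \<open>The summand \<open>\<epsilon>\<close> absorbs the diagonal term of \<open>chaos_bound\<close>.\<close>
  define Z where "Z s x = \<epsilon> + (\<Sum>p\<in>UNIV. 1 / R * (\<tau> * (Y s x p)\<^sup>2))" for s x
  have b: "(b s i)\<^sup>2 \<le> (\<theta> i)\<^sup>2" "c ^ s * b s i = \<theta> i ^ Suc s" if "i < n" for s i
  proof -
    have "(\<theta> i / c) ^ s \<le> 1" using \<theta>[OF that] c by (intro power_le_one) auto
    then have "b s i \<le> \<theta> i * 1" unfolding b_def using \<theta>(1)[OF that] by (intro mult_left_mono) auto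
    then show "(b s i)\<^sup>2 \<le> (\<theta> i)\<^sup>2"
      using \<theta>(1)[OF that] c by (intro power_mono) (auto simp: b_def)
    show "c ^ s * b s i = \<theta> i ^ Suc s" using c by (simp add: b_def power_divide)
  qed
  have pointwise: "ennreal (exp (?S x)) \<le> (\<Sum>s. ennreal (w s * exp (Z s x)))"
    if x: "\<And>i k. i < n \<Longrightarrow> \<bar>y (x i) k\<bar> \<le> 1" for x
  proof (rule exp_sums_le[OF w1 w0])
    show "(\<lambda>s. \<Sum>(i, j)\<in>edges n. \<theta> i ^ Suc s * \<theta> j ^ Suc s * T x i j) sums ?S x"
      unfolding T
    proof (rule sums_sum, clarify)
      fix i j assume "(i, j) \<in> edges n"
      then have ij: "i < n" "j < n" by (auto simp: edges_def)
      have "\<theta> i * \<theta> j \<le> c * c" using \<theta> ij c by (intro mult_mono) (auto intro: less_imp_le)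
      moreover have "0 < \<theta> i * \<theta> j" using \<theta>(1) ij by simp
      ultimately have "norm (\<theta> i * \<theta> j) < 1"
        using c2 unfolding real_norm_def power2_eq_square by linarith
      from sums_mult2[OF sums_mult[OF geometric_sums[OF this]], of "\<theta> i * \<theta> j" "T x i j"]
      show "(\<lambda>s. \<theta> i ^ Suc s * \<theta> j ^ Suc s * T x i j) sums (\<theta> i * \<theta> j / (1 - \<theta> i * \<theta> j) * T x i j)"
        by (simp add: power_mult_distrib ac_simps)
    qed
    fix s
    have \<xi>: "\<bar>\<xi> x i p\<bar> \<le> 1" if "i < n" for i p
      using x[OF that] z1[OF that] by (auto simp: \<xi>_def abs_mult mult_le_one split: prod.split)
    have "(\<Sum>(i, j)\<in>edges n. \<theta> i ^ Suc s * \<theta> j ^ Suc s * T x i j) \<le>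
        \<gamma>\<^sup>2 / 2 * (R * (\<Sum>p\<in>UNIV. (\<Sum>i<n. \<theta> i ^ Suc s * \<xi> x i p)\<^sup>2) + R\<^sup>2 * (\<Sum>i<n. (\<theta> i ^ Suc s)\<^sup>2))"
      unfolding T_def R_def using chaos_bound[of H "\<gamma>\<^sup>2" n "\<xi> x" "\<lambda>i. \<theta> i ^ Suc s", OF H(2,1) \<xi>] by simp
    also have "\<dots> \<le> \<gamma>\<^sup>2 / 2 * (R * (\<Sum>p\<in>UNIV. (c ^ s * Y s x p)\<^sup>2) + R\<^sup>2 * ((c ^ s)\<^sup>2 * V))"
    proof (intro mult_left_mono add_mono)
      have "(\<Sum>i<n. \<theta> i ^ Suc s * \<xi> x i p) = c ^ s * Y s x p" for p
        unfolding Y_def sum_distrib_left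
        by (intro sum.cong refl) (simp add: b(2)[symmetric] \<xi>_def case_prod_unfold del: power_Suc)
      then show "(\<Sum>p\<in>UNIV. (\<Sum>i<n. \<theta> i ^ Suc s * \<xi> x i p)\<^sup>2) \<le> (\<Sum>p\<in>UNIV. (c ^ s * Y s x p)\<^sup>2)" by simp
      show "(\<Sum>i<n. (\<theta> i ^ Suc s)\<^sup>2) \<le> (c ^ s)\<^sup>2 * V"
        unfolding V_def sum_distrib_left
        by (intro sum_mono) (simp add: b(2)[symmetric] power_mult_distrib mult_left_mono b(1) del: power_Suc)
    qed (use R in auto)
    also have "\<dots> = (\<gamma>\<^sup>2 / 2 * R\<^sup>2) * (c ^ s)\<^sup>2 * ((\<Sum>p\<in>UNIV. (Y s x p)\<^sup>2) / R + V)"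
      using R by (simp add: power_mult_distrib sum_distrib_left[symmetric] field_simps power2_eq_square)
    also have "\<dots> = w s * Z s x"
      unfolding \<tau>(2) by (simp add: w_def Z_def \<epsilon>_eq sum_distrib_left[symmetric] sum_divide_distrib[symmetric] algebra_simps)
    finally show "(\<Sum>(i, j)\<in>edges n. \<theta> i ^ Suc s * \<theta> j ^ Suc s * T x i j) \<le> w s * Z s x" .
  qed
  have moment: "(\<integral>\<^sup>+x. ennreal (exp (Z s x)) \<partial>?M) \<le> ennreal (exp \<epsilon> / sqrt (1 - 2 * \<epsilon>))" for s
    unfolding Z_def Y_def \<epsilon>_eq R_def
  proof (rule exp_mixture_moment)
    fix p :: "'k \<times> 'k"
    have "(b s i * z i (snd p))\<^sup>2 \<le> (\<theta> i)\<^sup>2" if "i < n" for i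
    proof -
      have "(z i (snd p))\<^sup>2 \<le> 1" using z1[OF that] by (simp add: abs_square_le_1)
      then show ?thesis
        using mult_mono[OF b(1)[OF that]] by (fastforce simp: power_mult_distrib)
    qed
    then show "(\<Sum>i<n. (b s i * z i (snd p))\<^sup>2) \<le> V"
      unfolding V_def by (intro sum_mono) auto
  qed (use y1 y0 \<tau>(1) \<epsilon>(2) \<epsilon>_eq in auto)
  have [measurable]: "Z s \<in> borel_measurable ?M" for s
    unfolding Z_def Y_def by measurable
  have "AE x in ?M. \<forall>k. \<bar>y (x i) k\<bar> \<le> 1" if "i < n" for i
    using that y1 by (intro AE_PiM_component) (auto simp: AE_all_countable intro: prob_space_axioms)
  then have "AE x in ?M. \<forall>i\<in>{..<n}. \<forall>k. \<bar>y (x i) k\<bar> \<le> 1"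
    by (intro AE_finite_allI) auto
  then have "AE x in ?M. ennreal (exp (?S x)) \<le> (\<Sum>s. ennreal (w s * exp (Z s x)))"
    by (rule eventually_mono) (rule pointwise, blast)
  then have "(\<integral>\<^sup>+x. ennreal (exp (?S x)) \<partial>?M) \<le> (\<integral>\<^sup>+x. (\<Sum>s. ennreal (w s * exp (Z s x))) \<partial>?M)"
    by (rule nn_integral_mono_AE)
  also have "\<dots> = (\<Sum>s. \<integral>\<^sup>+x. ennreal (w s * exp (Z s x)) \<partial>?M)"
    by (intro nn_integral_suminf) measurable
  also have "\<dots> = (\<Sum>s. ennreal (w s) * (\<integral>\<^sup>+x. ennreal (exp (Z s x)) \<partial>?M))"
    using w0 by (simp add: ennreal_mult nn_integral_cmult)
  also have "\<dots> \<le> (\<Sum>s. ennreal (w s) * ennreal (exp \<epsilon> / sqrt (1 - 2 * \<epsilon>)))"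
    by (intro suminf_le mult_left_mono moment) auto
  also have "\<dots> = ennreal (exp \<epsilon> / sqrt (1 - 2 * \<epsilon>))"
    using suminf_ennreal_eq[OF w0 w1] by (simp add: ennreal_suminf_multc)
  finally show ?thesis .
qed

section \<open>The chi-square distance of a mixture\<close>

lemma pmf_map_inj_on:
  assumes "inj_on h A" "set_pmf p \<subseteq> A" "x \<in> A"
  shows "pmf (map_pmf h p) (h x) = pmf p x"
proof (cases "x \<in> set_pmf p")
  case True
  then show ?thesis using assms by (intro pmf_map_inj) (auto intro: inj_on_subset)
next
  case False
  then have "h x \<notin> h ` set_pmf p"
    using assms by (auto dest: inj_onD)
  then have "pmf (map_pmf h p) (h x) = 0"
    by (subst pmf_eq_0_set_pmf) simp
  with False show ?thesis
    by (metis pmf_eq_0_set_pmf)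
qed

lemma likelihood_product_identity:
  fixes p q r :: real
  assumes "0 < p" "p < 1"
  shows "1 + (q - p) * (r - p) / (p * (1 - p)) = q * r / p + (1 - q) * (1 - r) / (1 - p)"
  using assms by (simp add: field_simps)

text \<open>
  The sum is the mean under \<open>p\<close> of a product over the edges of functions of the independent
  coins, and each factor is a sum over the two outcomes of one coin.
\<close>

lemma bernoulli_likelihood_sum:
  assumes "finite E" and p: "\<And>x. x \<in> E \<Longrightarrow> 0 < p x \<and> p x < 1"
    and q: "\<And>x. x \<in> E \<Longrightarrow> q x \<in> {0..1}" and r: "\<And>x. x \<in> E \<Longrightarrow> r x \<in> {0..1}"
  shows "(\<Sum>e\<in>PiE_dflt E False (\<lambda>_. UNIV).
      pmf (Pi_pmf E False (\<lambda>x. bernoulli_pmf (q x))) e * pmf (Pi_pmf E False (\<lambda>x. bernoulli_pmf (r x))) e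
        / pmf (Pi_pmf E False (\<lambda>x. bernoulli_pmf (p x))) e) =
    (\<Prod>x\<in>E. 1 + (q x - p x) * (r x - p x) / (p x * (1 - p x)))" (is "(\<Sum>e\<in>?A. _) = _")
proof -
  define B where "B s x = pmf (bernoulli_pmf (s x :: real))" for s and x :: 'a
  have pmf: "pmf (Pi_pmf E False (\<lambda>x. bernoulli_pmf (s x))) e = (\<Prod>x\<in>E. B s x (e x))" if "e \<in> ?A" for s e
    using that \<open>finite E\<close> unfolding B_def by (intro pmf_Pi') (auto simp: PiE_dflt_def)
  have "finite ?A" using \<open>finite E\<close> by (intro finite_PiE_dflt) auto
  have "(\<Sum>e\<in>?A. pmf (Pi_pmf E False (\<lambda>x. bernoulli_pmf (q x))) e * pmf (Pi_pmf E False (\<lambda>x. bernoulli_pmf (r x))) e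
        / pmf (Pi_pmf E False (\<lambda>x. bernoulli_pmf (p x))) e) =
      (\<Sum>e\<in>?A. pmf (Pi_pmf E False (\<lambda>x. bernoulli_pmf (p x))) e *\<^sub>R
        (\<Prod>x\<in>E. B q x (e x) * B r x (e x) / (B p x (e x))\<^sup>2))"
    by (intro sum.cong refl) (simp add: pmf prod_dividef prod.distrib power2_eq_square)
  also have "\<dots> = measure_pmf.expectation (Pi_pmf E False (\<lambda>x. bernoulli_pmf (p x)))
      (\<lambda>e. \<Prod>x\<in>E. B q x (e x) * B r x (e x) / (B p x (e x))\<^sup>2)"
    using set_Pi_pmf_subset[OF \<open>finite E\<close>, of False] \<open>finite ?A\<close>
    by (subst integral_measure_pmf[of ?A]) (auto simp: PiE_dflt_def)
  also have "\<dots> = (\<Prod>x\<in>E. measure_pmf.expectation (bernoulli_pmf (p x))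
      (\<lambda>b. B q x b * B r x b / (B p x b)\<^sup>2))"
    using \<open>finite E\<close> by (intro expectation_prod_Pi_pmf) (auto simp: B_def intro: integrable_measure_pmf_finite)
  also have "\<dots> = (\<Prod>x\<in>E. 1 + (q x - p x) * (r x - p x) / (p x * (1 - p x)))"
  proof (intro prod.cong refl)
    fix x assume x: "x \<in> E"
    have "measure_pmf.expectation (bernoulli_pmf (p x)) (\<lambda>b. B q x b * B r x b / (B p x b)\<^sup>2) =
        q x * r x / (p x)\<^sup>2 * p x + (1 - q x) * (1 - r x) / (1 - p x)\<^sup>2 * (1 - p x)"
      using p[OF x] q[OF x] r[OF x] by (simp add: B_def)
    also have "\<dots> = q x * r x / p x + (1 - q x) * (1 - r x) / (1 - p x)"
      using p[OF x] by (simp add: power2_eq_square)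
    also have "\<dots> = 1 + (q x - p x) * (r x - p x) / (p x * (1 - p x))"
      using p[OF x] by (simp add: likelihood_product_identity)
    finally show "measure_pmf.expectation (bernoulli_pmf (p x)) (\<lambda>b. B q x b * B r x b / (B p x b)\<^sup>2) =
        1 + (q x - p x) * (r x - p x) / (p x * (1 - p x))" .
  qed
  finally show ?thesis .
qed

lemma measurable_pmf_kernel:
  fixes f :: "'a \<Rightarrow> 'b pmf"
  assumes "finite S" and supp: "\<And>x. set_pmf (f x) \<subseteq> S"
    and meas: "\<And>b. (\<lambda>x. pmf (f x) b) \<in> borel_measurable M"
  shows "(\<lambda>x. measure_pmf (f x)) \<in> measurable M (subprob_algebra (count_space UNIV))"
proof (rule measurable_subprob_algebra)
  fix A :: "'b set"
  have "emeasure (measure_pmf (f x)) A = (\<Sum>b\<in>A \<inter> S. ennreal (pmf (f x) b))" for x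
  proof -
    have "emeasure (measure_pmf (f x)) A = emeasure (measure_pmf (f x)) (A \<inter> S)"
      using supp[of x] by (intro emeasure_eq_AE) (auto simp: AE_measure_pmf_iff)
    then show ?thesis using \<open>finite S\<close> by (simp add: emeasure_measure_pmf_finite)
  qed
  then show "(\<lambda>x. emeasure (measure_pmf (f x)) A) \<in> borel_measurable M"
    using meas by simp
qed (auto intro: measure_pmf.subprob_space_axioms)

text \<open>
  On a finite support the mixture has the masses \<open>q b = \<integral> pmf (f x) b\<close>, and
  \<open>\<chi>\<^sup>2 + 1 = \<Sum>b. (q b)\<^sup>2 / p b\<close>. Writing \<open>(q b)\<^sup>2\<close> as a double integral gives the two
  replicas; it suffices to bound the inner integral for almost every fixed value of the outer
  variable.
\<close>

lemma chi_square_mixture: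
  fixes f :: "'a \<Rightarrow> 'b pmf" and p :: "'b pmf"
  assumes M: "prob_space M" and fin: "finite (set_pmf p)"
    and supp: "\<And>x. set_pmf (f x) \<subseteq> set_pmf p"
    and meas[measurable]: "\<And>b. (\<lambda>x. pmf (f x) b) \<in> borel_measurable M"
    and bound: "AE x' in M. (\<integral>\<^sup>+x. ennreal (\<Sum>b\<in>set_pmf p. pmf (f x) b * pmf (f x') b / pmf p b) \<partial>M) \<le> ennreal B"
    and B: "0 \<le> B"
  shows "0 \<le> chi_square_dist (measure_pmf p) (M \<bind> (\<lambda>x. measure_pmf (f x)))"
    and "chi_square_dist (measure_pmf p) (M \<bind> (\<lambda>x. measure_pmf (f x))) \<le> ereal (B - 1)"
proof -
  interpret M: prob_space M by fact
  let ?S = "set_pmf p"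
  define N where "N = M \<bind> (\<lambda>x. measure_pmf (f x))"
  have ker: "(\<lambda>x. measure_pmf (f x)) \<in> measurable M (subprob_algebra (count_space UNIV))"
    by (rule measurable_pmf_kernel[OF fin supp meas])
  have sets_N: "sets N = UNIV"
    unfolding N_def by (subst sets_bind[of _ _ "count_space UNIV"]) (auto simp: M.not_empty)
  have N: "emeasure N A = (\<integral>\<^sup>+x. emeasure (measure_pmf (f x)) A \<partial>M)" for A
    unfolding N_def by (rule emeasure_bind[OF M.not_empty ker]) simp
  define q where "q b = (\<integral>x. pmf (f x) b \<partial>M)" for b
  have int: "integrable M (\<lambda>x. pmf (f x) b)" for b
    by (rule M.integrable_const_bound[of _ 1]) (auto simp: pmf_le_1)
  have q0: "0 \<le> q b" for b unfolding q_def by (intro integral_nonneg_AE) auto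
  have N_single: "emeasure N {b} = ennreal (q b)" for b
    unfolding N q_def by (subst nn_integral_eq_integral[symmetric, OF int]) (auto simp: emeasure_pmf_single)
  have sum_q: "(\<Sum>b\<in>?S. q b) = 1"
  proof -
    have "(\<Sum>b\<in>?S. q b) = (\<integral>x. (\<Sum>b\<in>?S. pmf (f x) b) \<partial>M)"
      unfolding q_def by (subst Bochner_Integration.integral_sum) (auto intro: int)
    also have "\<dots> = 1"
      using sum_pmf_eq_1[OF fin supp] by (simp add: M.prob_space)
    finally show ?thesis .
  qed
  have ac: "absolutely_continuous (measure_pmf p) N"
    unfolding absolutely_continuous_def
  proof (safe intro!: null_setsI)
    fix A assume "A \<in> null_sets (measure_pmf p)"
    then have "A \<inter> ?S = {}"
      by (auto simp: null_sets_def measure_pmf.emeasure_eq_measure measure_pmf_zero_iff)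
    then have "emeasure (measure_pmf (f x)) A = 0" for x
      using supp[of x] by (auto simp: measure_pmf.emeasure_eq_measure measure_pmf_zero_iff)
    then show "emeasure N A = 0" by (simp add: N)
  qed (simp add: sets_N)
  have RN: "RN_deriv (measure_pmf p) N b * ennreal (pmf p b) = ennreal (q b)" for b
  proof -
    have "density (measure_pmf p) (RN_deriv (measure_pmf p) N) = N"
      by (rule measure_pmf.density_RN_deriv[OF ac]) (simp add: sets_N)
    then have "emeasure N {b} = emeasure (density (measure_pmf p) (RN_deriv (measure_pmf p) N)) {b}" by simp
    also have "\<dots> = RN_deriv (measure_pmf p) N b * ennreal (pmf p b)"
      by (subst emeasure_density) (auto simp: emeasure_pmf_single)
    finally show ?thesis by (simp add: N_single)
  qed
  have sq: "(\<integral>\<^sup>+b. (RN_deriv (measure_pmf p) N b)\<^sup>2 \<partial>measure_pmf p) = ennreal (\<Sum>b\<in>?S. (q b)\<^sup>2 / pmf p b)"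
  proof -
    have "(RN_deriv (measure_pmf p) N b)\<^sup>2 * ennreal (pmf p b) = ennreal ((q b)\<^sup>2 / pmf p b)" if "b \<in> ?S" for b
    proof -
      have pos: "0 < pmf p b" using that by (simp add: pmf_positive)
      have "RN_deriv (measure_pmf p) N b = RN_deriv (measure_pmf p) N b * ennreal (pmf p b) * ennreal (1 / pmf p b)"
        using pos by (simp add: mult.assoc ennreal_mult[symmetric])
      also have "\<dots> = ennreal (q b / pmf p b)"
        using q0 by (simp add: RN ennreal_mult[symmetric])
      finally show ?thesis
        using pos q0 by (simp add: ennreal_mult[symmetric] ennreal_power power2_eq_square)
    qed
    then show ?thesis
      using q0 by (simp add: nn_integral_measure_pmf_finite[OF fin])
  qed
  define X where "X = (\<Sum>b\<in>?S. (q b)\<^sup>2 / pmf p b)"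
  have chi: "chi_square_dist (measure_pmf p) N = ereal (X - 1)"
    using ac q0 by (simp add: chi_square_dist_def sq X_def[symmetric] enn2ereal_ennreal sum_nonneg one_ereal_def)
      (simp add: X_def enn2ereal_ennreal sum_nonneg)
  \<comment> \<open>Since \<open>(q - p)\<^sup>2 \<ge> 0\<close>, each summand is at least \<open>2 q - p\<close>.\<close>
  have "1 \<le> X"
  proof -
    have "2 * q b - pmf p b \<le> (q b)\<^sup>2 / pmf p b" if "b \<in> ?S" for b
    proof -
      have "0 \<le> (q b - pmf p b)\<^sup>2 / pmf p b" by simp
      also have "\<dots> = (q b)\<^sup>2 / pmf p b - (2 * q b - pmf p b)"
        using pmf_positive[OF that] by (simp add: power2_eq_square field_simps)
      finally show ?thesis by simp
    qed
    then have "(\<Sum>b\<in>?S. 2 * q b - pmf p b) \<le> X"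
      unfolding X_def by (rule sum_mono)
    then show ?thesis
      using sum_q sum_pmf_eq_1[OF fin subset_refl] by (simp add: sum_subtractf sum_distrib_left[symmetric])
  qed
  then show "0 \<le> chi_square_dist (measure_pmf p) (M \<bind> (\<lambda>x. measure_pmf (f x)))"
    using chi by (simp add: N_def)
  have "ennreal X = (\<integral>\<^sup>+x'. (\<integral>\<^sup>+x. ennreal (\<Sum>b\<in>?S. pmf (f x) b * pmf (f x') b / pmf p b) \<partial>M) \<partial>M)"
  proof -
    have "(\<integral>\<^sup>+x. ennreal (\<Sum>b\<in>?S. pmf (f x) b * pmf (f x') b / pmf p b) \<partial>M) =
        ennreal (\<Sum>b\<in>?S. q b * pmf (f x') b / pmf p b)" for x'
    proof -
      have "(\<integral>\<^sup>+x. ennreal (\<Sum>b\<in>?S. pmf (f x) b * pmf (f x') b / pmf p b) \<partial>M) =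
          ennreal (\<integral>x. (\<Sum>b\<in>?S. pmf (f x) b * pmf (f x') b / pmf p b) \<partial>M)"
        by (intro nn_integral_eq_integral) (auto intro!: sum_nonneg Bochner_Integration.integrable_sum
          integrable_divide integrable_mult_left integrable_mult_right int)
      then show ?thesis
        by (simp add: q_def int)
    qed
    moreover have "(\<integral>\<^sup>+x'. ennreal (\<Sum>b\<in>?S. q b * pmf (f x') b / pmf p b) \<partial>M) = ennreal X"
    proof -
      have "(\<integral>\<^sup>+x'. ennreal (\<Sum>b\<in>?S. q b * pmf (f x') b / pmf p b) \<partial>M) =
          ennreal (\<integral>x'. (\<Sum>b\<in>?S. q b * pmf (f x') b / pmf p b) \<partial>M)"
        using q0 by (intro nn_integral_eq_integral) (auto intro!: sum_nonneg Bochner_Integration.integrable_sum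
          integrable_divide integrable_mult_left integrable_mult_right int)
      then show ?thesis
        by (simp add: q_def[symmetric] int X_def power2_eq_square)
    qed
    ultimately show ?thesis by simp
  qed
  also have "\<dots> \<le> (\<integral>\<^sup>+x'. ennreal B \<partial>M)"
    by (rule nn_integral_mono_AE[OF bound])
  also have "\<dots> = ennreal B" by (simp add: M.emeasure_space_1)
  finally have "X \<le> B" using B by simp
  then show "chi_square_dist (measure_pmf p) (M \<bind> (\<lambda>x. measure_pmf (f x))) \<le> ereal (B - 1)"
    using chi by (simp add: N_def)
qed

section \<open>Degree-corrected mixed membership graphs\<close>

definition adjacency_of :: "(nat \<times> nat \<Rightarrow> bool) \<Rightarrow> nat \<Rightarrow> nat \<Rightarrow> nat" where
  "adjacency_of e i j =
     (if i < j then of_bool (e (i, j)) else if j < i then of_bool (e (j, i)) else 0)"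

text \<open>The edge configurations, with the default value \<open>False\<close> off the edges as in \<open>Pi_pmf\<close>. On them
  \<open>adjacency_of\<close> is injective, so sums over adjacency matrices can be moved to edge configurations.\<close>

definition graphs :: "nat \<Rightarrow> (nat \<times> nat \<Rightarrow> bool) set" where
  "graphs n = PiE_dflt (edges n) False (\<lambda>_. UNIV)"

lemma finite_graphs: "finite (graphs n)"
  unfolding graphs_def by (intro finite_PiE_dflt) auto

lemma inj_on_adjacency_of: "inj_on adjacency_of (graphs n)"
proof (rule inj_onI, rule ext, clarify)
  fix e e' i j
  assume e: "e \<in> graphs n" "e' \<in> graphs n" and eq: "adjacency_of e = adjacency_of e'"
  show "e (i, j) = e' (i, j)"
  proof (cases "(i, j) \<in> edges n")
    case True
    then show ?thesis
      using fun_cong[OF fun_cong[OF eq, of i], of j] by (auto simp: adjacency_of_def edges_def of_bool_def split: if_splits)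
  next
    case False
    then show ?thesis using e by (auto simp: graphs_def PiE_dflt_def)
  qed
qed

lemma adjacency_pmf_eq:
  "adjacency_pmf n \<Omega> =
     map_pmf adjacency_of (Pi_pmf (edges n) False (\<lambda>x. bernoulli_pmf (case x of (i, j) \<Rightarrow> \<Omega> i j)))"
  by (simp add: adjacency_pmf_def adjacency_of_def[abs_def] edges_def case_prod_unfold)

lemma set_Pi_pmf_graphs: "set_pmf (Pi_pmf (edges n) False p) \<subseteq> graphs n"
  using set_Pi_pmf_subset[of "edges n" False p] by (auto simp: graphs_def PiE_dflt_def)

lemma set_adjacency_pmf: "set_pmf (adjacency_pmf n \<Omega>) \<subseteq> adjacency_of ` graphs n"
  unfolding adjacency_pmf_eq set_map_pmf by (intro image_mono set_Pi_pmf_graphs)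

lemma set_adjacency_pmf_eq:
  assumes "\<And>i j. (i, j) \<in> edges n \<Longrightarrow> 0 < \<Omega> i j \<and> \<Omega> i j < 1"
  shows "set_pmf (adjacency_pmf n \<Omega>) = adjacency_of ` graphs n"
proof -
  have "set_pmf (bernoulli_pmf (case x of (i, j) \<Rightarrow> \<Omega> i j)) = UNIV" if "x \<in> edges n" for x
    using assms[of "fst x" "snd x"] that by (cases x) auto
  then show ?thesis
    by (auto simp: adjacency_pmf_eq set_Pi_pmf graphs_def PiE_dflt_def)
qed

lemma pmf_adjacency_of:
  assumes "e \<in> graphs n"
  shows "pmf (adjacency_pmf n \<Omega>) (adjacency_of e) =
    pmf (Pi_pmf (edges n) False (\<lambda>x. bernoulli_pmf (case x of (i, j) \<Rightarrow> \<Omega> i j))) e"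
  unfolding adjacency_pmf_eq
  using inj_on_adjacency_of set_Pi_pmf_graphs assms by (rule pmf_map_inj_on)

lemma pmf_bernoulli_clip:
  "pmf (bernoulli_pmf p) b = (if b then min 1 (max 0 p) else 1 - min 1 (max 0 p))"
proof -
  interpret pmf_as_function .
  show ?thesis by transfer simp
qed

lemma measurable_pmf_adjacency:
  assumes "\<And>i j. (i, j) \<in> edges n \<Longrightarrow> (\<lambda>x. \<Omega> x i j) \<in> borel_measurable M"
  shows "(\<lambda>x. pmf (adjacency_pmf n (\<Omega> x)) a) \<in> borel_measurable M"
proof (cases "a \<in> adjacency_of ` graphs n")
  case True
  then obtain e where e: "e \<in> graphs n" "a = adjacency_of e" by blast
  have "pmf (adjacency_pmf n (\<Omega> x)) a =
      (\<Prod>z\<in>edges n. pmf (bernoulli_pmf (\<Omega> x (fst z) (snd z))) (e z))" for x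
    using e by (simp add: pmf_adjacency_of) (subst pmf_Pi', auto simp: graphs_def PiE_dflt_def case_prod_unfold)
  moreover have "(\<lambda>x. pmf (bernoulli_pmf (\<Omega> x (fst z) (snd z))) (e z)) \<in> borel_measurable M"
    if "z \<in> edges n" for z
    using assms[of "fst z" "snd z"] that by (simp add: pmf_bernoulli_clip)
  ultimately show ?thesis by simp
next
  case False
  then have "pmf (adjacency_pmf n (\<Omega> x)) a = 0" for x
    using set_adjacency_pmf by (subst pmf_eq_0_set_pmf) blast
  then show ?thesis by simp
qed

text \<open>
  Each factor of the likelihood sum is \<open>1 + t / (1 - t) * T * T'\<close> with \<open>t = \<theta>\<^sub>i \<theta>\<^sub>j\<close>. It is
  at most the exponential of the added term; to multiply these bounds the factors must be
  nonnegative, and this uses that \<open>\<Omega>\<close> and \<open>\<Omega>'\<close> are probabilities.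
\<close>

lemma likelihood_ratio_moment_le_exp:
  assumes \<theta>: "\<And>i j. (i, j) \<in> edges n \<Longrightarrow> 0 < \<theta> i * \<theta> j \<and> \<theta> i * \<theta> j < 1"
    and \<Omega>: "\<And>i j. (i, j) \<in> edges n \<Longrightarrow> \<Omega> i j \<in> {0..1} \<and> \<Omega> i j = \<theta> i * \<theta> j * (1 + T i j)"
    and \<Omega>': "\<And>i j. (i, j) \<in> edges n \<Longrightarrow> \<Omega>' i j \<in> {0..1} \<and> \<Omega>' i j = \<theta> i * \<theta> j * (1 + T' i j)"
  shows "(\<Sum>a\<in>set_pmf (adjacency_pmf n (Omega_null \<theta>)).
      pmf (adjacency_pmf n \<Omega>) a * pmf (adjacency_pmf n \<Omega>') a / pmf (adjacency_pmf n (Omega_null \<theta>)) a)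
    \<le> exp (\<Sum>(i, j)\<in>edges n. \<theta> i * \<theta> j / (1 - \<theta> i * \<theta> j) * (T i j * T' i j))"
proof -
  let ?p = "\<lambda>x. case x of (i, j) \<Rightarrow> Omega_null \<theta> i j"
  let ?q = "\<lambda>x. case x of (i, j) \<Rightarrow> \<Omega> i j" and ?r = "\<lambda>x. case x of (i, j) \<Rightarrow> \<Omega>' i j"
  have p: "0 < ?p x \<and> ?p x < 1" if "x \<in> edges n" for x
    using \<theta>[of "fst x" "snd x"] that by (cases x) (simp add: Omega_null_def)
  have q: "?q x \<in> {0..1}" and r: "?r x \<in> {0..1}" if "x \<in> edges n" for x
    using \<Omega> \<Omega>' that by (cases x, simp)+
  have S: "set_pmf (adjacency_pmf n (Omega_null \<theta>)) = adjacency_of ` graphs n"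
    using \<theta> by (intro set_adjacency_pmf_eq) (auto simp: Omega_null_def)
  have "(\<Sum>a\<in>set_pmf (adjacency_pmf n (Omega_null \<theta>)).
      pmf (adjacency_pmf n \<Omega>) a * pmf (adjacency_pmf n \<Omega>') a / pmf (adjacency_pmf n (Omega_null \<theta>)) a) =
      (\<Prod>x\<in>edges n. 1 + (?q x - ?p x) * (?r x - ?p x) / (?p x * (1 - ?p x)))"
    unfolding S sum.reindex[OF inj_on_adjacency_of]
    using bernoulli_likelihood_sum[OF finite_edges p q r, folded graphs_def]
    by (simp add: pmf_adjacency_of cong: sum.cong)
  also have "\<dots> \<le> (\<Prod>x\<in>edges n. exp (case x of (i, j) \<Rightarrow> \<theta> i * \<theta> j / (1 - \<theta> i * \<theta> j) * (T i j * T' i j)))"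
  proof (intro prod_mono conjI, goal_cases)
    case (1 x)
    have "1 + (?q x - ?p x) * (?r x - ?p x) / (?p x * (1 - ?p x)) =
        ?q x * ?r x / ?p x + (1 - ?q x) * (1 - ?r x) / (1 - ?p x)"
      using p[OF 1] by (intro likelihood_product_identity) auto
    also have "\<dots> \<ge> 0"
      using p[OF 1] q[OF 1] r[OF 1] by (intro add_nonneg_nonneg divide_nonneg_pos mult_nonneg_nonneg) auto
    finally show ?case .
  next
    case (2 x)
    obtain i j where x: "x = (i, j)" by (cases x)
    define t where "t = \<theta> i * \<theta> j"
    have t: "0 < t" "t < 1" using \<theta> 2 by (auto simp: x t_def)
    have "(\<Omega> i j - t) * (\<Omega>' i j - t) / (t * (1 - t)) = (t * T i j) * (t * T' i j) / (t * (1 - t))"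
      using \<Omega>[of i j] \<Omega>'[of i j] 2 by (simp add: x t_def[symmetric] algebra_simps)
    also have "\<dots> = t / (1 - t) * (T i j * T' i j)"
      using t by simp
    finally show ?case
      using exp_ge_add_one_self[of "t / (1 - t) * (T i j * T' i j)"]
      by (simp add: x Omega_null_def t_def[symmetric])
  qed
  also have "\<dots> = exp (\<Sum>(i, j)\<in>edges n. \<theta> i * \<theta> j / (1 - \<theta> i * \<theta> j) * (T i j * T' i j))"
    by (simp add: exp_sum case_prod_unfold)
  finally show ?thesis .
qed

lemma chi_square_dist_DCMM_bound:
  fixes F :: "(real ^ 'k) measure" and P D :: "real ^ 'k ^ 'k" and \<theta> :: "nat \<Rightarrow> real"
  assumes card: "CARD('k) > 1"
    and F: "prob_space F" "sets F = sets borel" "AE x in F. x \<in> prob_simplex"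
    and \<theta>: "\<And>i. i < n \<Longrightarrow> 0 < \<theta> i" "\<And>i. i < n \<Longrightarrow> \<theta> i \<le> c" and c: "0 < c" "c < 1"
    and P: "transpose P = P" "\<And>k l. 0 \<le> P $ k $ l" "\<And>k. P $ k $ k = 1"
    and D: "pos_diagonal D" and fix_h: "(D ** P ** D) *v h_tilde F D = (\<chi> k. 1)"
    and C: "0 < C" "\<And>k. C \<le> h_tilde F D $ k"
    and \<Omega>: "AE \<pi> in membership_law n F. \<forall>i j. i < j \<and> j < n \<longrightarrow> Omega_alt \<theta> P D \<pi> i j \<in> {0..1}"
    and \<gamma>: "\<gamma> = 2 * (1 + 1 / sqrt C)\<^sup>2 * \<bar>eigenvalue_mag 2 P\<bar>"
    and \<epsilon>: "\<epsilon> = \<gamma>\<^sup>2 * CARD('k) ^ 4 / (2 * (1 - c\<^sup>2)) * (\<Sum>i<n. (\<theta> i)\<^sup>2)" "2 * \<epsilon> < 1"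
  shows "0 \<le> chi_square_dist (null_law n \<theta>) (alt_law n F \<theta> P D)"
    and "chi_square_dist (null_law n \<theta>) (alt_law n F \<theta> P D) \<le> ereal (exp \<epsilon> / sqrt (1 - 2 * \<epsilon>) - 1)"
proof -
  interpret F: prob_space F by (rule F(1))
  define h where "h = h_tilde F D"
  define Q where "Q = D ** P ** D"
  define y where "y x k = (profile D x - h) $ k" for x k
  define G where "G k l = Q $ k $ l - 1" for k l
  define M where "M = (\<Pi>\<^sub>M i\<in>{..<n}. F)"
  have prob_M: "prob_space M" unfolding M_def by (rule prob_space_PiM) (rule F(1))
  define p where "p = adjacency_pmf n (Omega_null \<theta>)"
  define f where "f \<pi> = adjacency_pmf n (Omega_alt \<theta> P D \<pi>)" for \<pi>
  have h: "h \<in> prob_simplex" and mean: "\<And>k. F.expectation (\<lambda>x. y x k) = 0"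
    unfolding h_def y_def by (rule h_tilde_mean_profile[OF F D])+
  have symQ: "transpose Q = Q"
    using P(1) by (simp add: vec_eq_iff transpose_def Q_def pos_diagonal_sandwich[OF D] ac_simps)
  have G: "\<bar>G k l\<bar> \<le> \<gamma>" "G k l = G l k" for k l
    using sandwich_near_one[OF card P D fix_h C, of k l] h symQ
    by (auto simp: G_def Q_def \<gamma> h_def prob_simplex_def vec_eq_iff transpose_def)
  have y_le: "\<bar>y x k\<bar> \<le> 1" if "x \<in> prob_simplex" for x k
    using simplex_bounds(1,2)[OF h, of k] simplex_bounds(1,2)[OF profile_in_simplex[OF D that], of k]
    by (simp add: y_def abs_le_iff)
  have y_meas: "(\<lambda>x. y x k) \<in> borel_measurable F" for k
  proof -
    have nth: "(\<lambda>v :: real ^ 'k. v $ k) \<in> borel_measurable borel"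
      by (rule borel_measurable_continuous_onI) (rule linear_continuous_on[OF bounded_linear_vec_nth])
    have "(\<lambda>x. y x k) \<in> borel_measurable borel"
      unfolding y_def vector_minus_component
      by (rule borel_measurable_diff[OF measurable_compose[OF profile_measurable nth] borel_measurable_const])
    then show ?thesis by (simp add: measurable_cong_sets[OF F(2) refl])
  qed
  have Omega: "Omega_alt \<theta> P D \<pi> i j = \<theta> i * \<theta> j *
      (1 + (\<Sum>k\<in>UNIV. \<Sum>l\<in>UNIV. G k l * y (\<pi> i) k * y (\<pi> j) l))"
    if "\<pi> i \<in> prob_simplex" "\<pi> j \<in> prob_simplex" for \<pi> i j
    using Omega_alt_profile[OF D that, of \<theta> P]
      bilinear_centred[OF symQ fix_h[folded Q_def h_def] h profile_in_simplex[OF D that(1)] profile_in_simplex[OF D that(2)]]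
    by (simp add: Q_def[symmetric] G_def y_def)
  have Omega_meas: "(\<lambda>\<pi>. Omega_alt \<theta> P D \<pi> i j) \<in> borel_measurable M" if "(i, j) \<in> edges n" for i j
  proof -
    have comp: "(\<lambda>\<pi>. \<pi> i) \<in> borel_measurable M" if "i < n" for i
      using measurable_component_singleton[of i "{..<n}" "\<lambda>_. F"] that
      by (simp add: M_def measurable_cong_sets[OF refl F(2)])
    have lin: "(\<lambda>\<pi>. A *v \<pi> i) \<in> borel_measurable M" if "i < n" for i and A :: "real ^ 'k ^ 'k"
      by (rule measurable_compose[OF comp[OF that]])
        (intro borel_measurable_continuous_onI linear_continuous_on matrix_vector_mul_bounded_linear)
    have l1: "(\<lambda>\<pi>. l1_norm (matrix_inv D *v \<pi> i)) \<in> borel_measurable M" if "i < n" for i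
      unfolding l1_norm_def
      by (rule measurable_compose[OF lin[OF that]]) (intro borel_measurable_continuous_onI continuous_intros)
    show ?thesis
      using that unfolding Omega_alt_def theta_tilde_def
      by (intro borel_measurable_times borel_measurable_divide borel_measurable_inner borel_measurable_const
        comp lin l1) (auto simp: edges_def)
  qed
  have \<theta>\<theta>: "0 < \<theta> i * \<theta> j \<and> \<theta> i * \<theta> j < 1" if "(i, j) \<in> edges n" for i j
  proof -
    have ij: "i < n" "j < n" using that by (auto simp: edges_def)
    have "\<theta> i * \<theta> j \<le> c * c" using \<theta> ij c by (intro mult_mono) (auto intro: less_imp_le)
    also have "\<dots> < 1 * 1" using c by (intro mult_strict_mono) auto
    finally show ?thesis using \<theta>(1) ij by simp
  qed
  have AE_good: "AE \<pi> in M. (\<forall>i<n. \<pi> i \<in> prob_simplex) \<and>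
      (\<forall>i j. (i, j) \<in> edges n \<longrightarrow> Omega_alt \<theta> P D \<pi> i j \<in> {0..1})"
  proof -
    have "AE \<pi> in M. \<pi> i \<in> prob_simplex" if "i < n" for i
      unfolding M_def using that F by (intro AE_PiM_component) auto
    then have "AE \<pi> in M. \<forall>i\<in>{..<n}. \<pi> i \<in> prob_simplex"
      by (intro AE_finite_allI) auto
    moreover have "AE \<pi> in M. \<forall>i j. i < j \<and> j < n \<longrightarrow> Omega_alt \<theta> P D \<pi> i j \<in> {0..1}"
      using \<Omega> by (simp only: M_def membership_law_def)
    ultimately show ?thesis
      by eventually_elim (simp add: edges_def)
  qed
  have bound: "AE \<pi>' in M. (\<integral>\<^sup>+\<pi>. ennreal (\<Sum>a\<in>set_pmf p. pmf (f \<pi>) a * pmf (f \<pi>') a / pmf p a) \<partial>M)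
      \<le> ennreal (exp \<epsilon> / sqrt (1 - 2 * \<epsilon>))"
    using AE_good
  proof eventually_elim
    case (elim \<pi>')
    let ?T = "\<lambda>\<pi> i j. \<Sum>k\<in>UNIV. \<Sum>l\<in>UNIV. G k l * y (\<pi> i) k * y (\<pi> j) l"
    have good: "Omega_alt \<theta> P D \<pi> i j \<in> {0..1} \<and> Omega_alt \<theta> P D \<pi> i j = \<theta> i * \<theta> j * (1 + ?T \<pi> i j)"
      if "(\<forall>i<n. \<pi> i \<in> prob_simplex) \<and> (\<forall>i j. (i, j) \<in> edges n \<longrightarrow> Omega_alt \<theta> P D \<pi> i j \<in> {0..1})"
        "(i, j) \<in> edges n" for \<pi> i j
    proof
      show "Omega_alt \<theta> P D \<pi> i j \<in> {0..1}" using that by blast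
      show "Omega_alt \<theta> P D \<pi> i j = \<theta> i * \<theta> j * (1 + ?T \<pi> i j)"
        using that by (intro Omega) (auto simp: edges_def)
    qed
    have "(\<integral>\<^sup>+\<pi>. ennreal (\<Sum>a\<in>set_pmf p. pmf (f \<pi>) a * pmf (f \<pi>') a / pmf p a) \<partial>M) \<le>
        (\<integral>\<^sup>+\<pi>. ennreal (exp (\<Sum>(i, j)\<in>edges n. \<theta> i * \<theta> j / (1 - \<theta> i * \<theta> j) * (?T \<pi> i j * ?T \<pi>' i j))) \<partial>M)"
    proof (rule nn_integral_mono_AE)
      show "AE \<pi> in M. ennreal (\<Sum>a\<in>set_pmf p. pmf (f \<pi>) a * pmf (f \<pi>') a / pmf p a) \<le>
          ennreal (exp (\<Sum>(i, j)\<in>edges n. \<theta> i * \<theta> j / (1 - \<theta> i * \<theta> j) * (?T \<pi> i j * ?T \<pi>' i j)))"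
        using AE_good
      proof eventually_elim
        case (elim \<pi>)
        show ?case
          unfolding p_def f_def
          by (intro ennreal_leI likelihood_ratio_moment_le_exp \<theta>\<theta> good[OF elim] good[OF \<open>(\<forall>i<n. \<pi>' i \<in> prob_simplex) \<and> _\<close>])
      qed
    qed
    also have "\<dots> \<le> ennreal (exp \<epsilon> / sqrt (1 - 2 * \<epsilon>))"
      unfolding M_def
    proof (rule F.exp_chaos_moment[OF y_meas _ mean _ G(2,1) \<theta> c \<epsilon>])
      show "AE x in F. \<bar>y x k\<bar> \<le> 1" for k
        using F(3) by eventually_elim (rule y_le)
      show "\<bar>y (\<pi>' i) k\<bar> \<le> 1" if "i < n" for i k
        using elim that y_le by blast
    qed
    finally show ?case .
  qed
  have fin: "finite (set_pmf p)"
    unfolding p_def by (rule finite_subset[OF set_adjacency_pmf]) (simp add: finite_graphs)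
  have supp: "set_pmf (f \<pi>) \<subseteq> set_pmf p" for \<pi>
  proof -
    have "set_pmf p = adjacency_of ` graphs n"
      unfolding p_def using \<theta>\<theta> by (intro set_adjacency_pmf_eq) (simp add: Omega_null_def)
    then show ?thesis using set_adjacency_pmf by (simp add: f_def)
  qed
  have meas: "(\<lambda>\<pi>. pmf (f \<pi>) a) \<in> borel_measurable M" for a
    unfolding f_def by (intro measurable_pmf_adjacency Omega_meas)
  have "0 \<le> exp \<epsilon> / sqrt (1 - 2 * \<epsilon>)" using \<epsilon>(2) by simp
  note chi_square_mixture[OF prob_M fin supp meas bound this]
  then show "0 \<le> chi_square_dist (null_law n \<theta>) (alt_law n F \<theta> P D)"
    and "chi_square_dist (null_law n \<theta>) (alt_law n F \<theta> P D) \<le> ereal (exp \<epsilon> / sqrt (1 - 2 * \<epsilon>) - 1)"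
    by (simp_all add: null_law_def alt_law_def membership_law_def M_def p_def f_def)
qed

theorem theorem3p3:
  fixes F :: "(real ^ 'k) measure"
    and \<theta> :: "nat \<Rightarrow> nat \<Rightarrow> real"
    and P D :: "nat \<Rightarrow> real ^ 'k ^ 'k"
    and C c\<^sub>0 :: real
  assumes "CARD('k) > 1"
    and "prob_space F" and "sets F = sets borel" and "AE x in F. x \<in> prob_simplex"
    and "\<And>n i. n \<ge> 1 \<Longrightarrow> i < n \<Longrightarrow> 0 < \<theta> n i"
    and "\<And>n. n \<ge> 1 \<Longrightarrow> transpose (P n) = P n"
    and "\<And>n k l. n \<ge> 1 \<Longrightarrow> 0 \<le> P n $ k $ l"
    and "\<And>n k. n \<ge> 1 \<Longrightarrow> P n $ k $ k = 1"
    and "\<And>n. n \<ge> 1 \<Longrightarrow> pos_diagonal (D n)"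
    and "\<And>n. n \<ge> 1 \<Longrightarrow> (D n ** P n ** D n) *v h_tilde F (D n) = (\<chi> k. 1)"
    and "C > 0" and "\<And>n k. n \<ge> 1 \<Longrightarrow> C \<le> h_tilde F (D n) $ k"
    and "\<And>n. n \<ge> 1 \<Longrightarrow> AE \<pi> in membership_law n F.
           \<forall>i j. i < j \<and> j < n \<longrightarrow> Omega_alt (\<theta> n) (P n) (D n) \<pi> i j \<in> {0..1}"
    and "c\<^sub>0 < 1" and "\<And>n i. n \<ge> 1 \<Longrightarrow> i < n \<Longrightarrow> \<theta> n i \<le> c\<^sub>0"
    and "(\<lambda>n. L2_set (\<theta> n) {..<n} * \<bar>eigenvalue_mag 2 (P n)\<bar>) \<longlonglongrightarrow> 0"
  shows "(\<lambda>n. chi_square_dist (null_law n (\<theta> n)) (alt_law n F (\<theta> n) (P n) (D n))) \<longlonglongrightarrow> 0"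
proof -
  define \<epsilon> where "\<epsilon> n = (2 * (1 + 1 / sqrt C)\<^sup>2 * \<bar>eigenvalue_mag 2 (P n)\<bar>)\<^sup>2 * CARD('k) ^ 4 / (2 * (1 - c\<^sub>0\<^sup>2))
    * (\<Sum>i<n. (\<theta> n i)\<^sup>2)" for n
  have \<epsilon>_eq: "\<epsilon> n = (2 * (1 + 1 / sqrt C)\<^sup>2)\<^sup>2 * CARD('k) ^ 4 / (2 * (1 - c\<^sub>0\<^sup>2))
      * (L2_set (\<theta> n) {..<n} * \<bar>eigenvalue_mag 2 (P n)\<bar>)\<^sup>2" for n
    by (simp add: \<epsilon>_def power_mult_distrib L2_set_def sum_nonneg)
  have "(\<lambda>n. (2 * (1 + 1 / sqrt C)\<^sup>2)\<^sup>2 * CARD('k) ^ 4 / (2 * (1 - c\<^sub>0\<^sup>2))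
      * (L2_set (\<theta> n) {..<n} * \<bar>eigenvalue_mag 2 (P n)\<bar>)\<^sup>2) \<longlonglongrightarrow>
      (2 * (1 + 1 / sqrt C)\<^sup>2)\<^sup>2 * CARD('k) ^ 4 / (2 * (1 - c\<^sub>0\<^sup>2)) * 0\<^sup>2"
    by (intro tendsto_mult tendsto_const tendsto_power assms(16))
  then have \<epsilon>: "\<epsilon> \<longlonglongrightarrow> 0" unfolding \<epsilon>_eq[symmetric] by simp
  \<comment> \<open>The node \<open>0\<close> of the graph on one node witnesses this.\<close>
  have c0: "0 < c\<^sub>0" using assms(5)[of 1 0] assms(15)[of 1 0] by simp
  have ev: "eventually (\<lambda>n. n \<ge> 1 \<and> 2 * \<epsilon> n < 1) sequentially"
    using eventually_conj[OF eventually_ge_at_top[of 1] order_tendstoD(2)[OF \<epsilon>, of "1 / 2"]] by (simp add: mult.commute)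
  have nonneg: "0 \<le> chi_square_dist (null_law n (\<theta> n)) (alt_law n F (\<theta> n) (P n) (D n))"
    and upper: "chi_square_dist (null_law n (\<theta> n)) (alt_law n F (\<theta> n) (P n) (D n)) \<le>
        ereal (exp (\<epsilon> n) / sqrt (1 - 2 * \<epsilon> n) - 1)" if n: "n \<ge> 1" "2 * \<epsilon> n < 1" for n
    by (rule chi_square_dist_DCMM_bound[OF assms(1-4) assms(5)[OF n(1)] assms(15)[OF n(1)] c0 assms(14)
          assms(6)[OF n(1)] assms(7)[OF n(1)] assms(8)[OF n(1)] assms(9)[OF n(1)] assms(10)[OF n(1)]
          assms(11) assms(12)[OF n(1)] assms(13)[OF n(1)] refl \<epsilon>_def n(2)]; assumption)+
  have "(\<lambda>n. exp (\<epsilon> n) / sqrt (1 - 2 * \<epsilon> n) - 1) \<longlonglongrightarrow> exp 0 / sqrt (1 - 2 * 0) - 1"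
    by (intro tendsto_intros \<epsilon>) auto
  then have lim: "(\<lambda>n. ereal (exp (\<epsilon> n) / sqrt (1 - 2 * \<epsilon> n) - 1)) \<longlonglongrightarrow> 0"
    by (simp add: zero_ereal_def)
  show ?thesis
  proof (rule tendsto_sandwich[OF _ _ tendsto_const lim])
    show "\<forall>\<^sub>F n in sequentially. 0 \<le> chi_square_dist (null_law n (\<theta> n)) (alt_law n F (\<theta> n) (P n) (D n))"
      using ev by eventually_elim (simp add: nonneg)
    show "\<forall>\<^sub>F n in sequentially. chi_square_dist (null_law n (\<theta> n)) (alt_law n F (\<theta> n) (P n) (D n)) \<le>
        ereal (exp (\<epsilon> n) / sqrt (1 - 2 * \<epsilon> n) - 1)"
      using ev by eventually_elim (simp add: upper)
  qed
qed

end
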